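(* Let $A\cong A_1\oplus A_2$ be a finite abelian group where $A_1$ has odd order and $A_2\cong(\mathbb{Z}/2\mathbb{Z})^{a_1}\oplus(\mathbb{Z}/2^2\mathbb{Z})^{a_2}\oplus\cdots\oplus(\mathbb{Z}/2^t\mathbb{Z})^{a_t}$ with $a_i\neq 1$ for all $1\le i\le t$. Then there is a bireversible automaton over an $|A|$-element alphabet with $|A|$ states generating a group isomorphic to $A\wr\mathbb{Z}$.
   Context: The exponents $a_i$ are non-negative integers. $A\wr\mathbb{Z}$ denotes the restricted wreath product $\left(\bigoplus_{\mathbb{Z}}A\right)\rtimes\mathbb{Z}$, with $\mathbb{Z}$ acting by shifting the coordinates. A (Mealy) automaton is a 4-tuple $\mathcal{A}=(Q,X,\delta,\lambda)$ with state set $Q$, finite alphabet $X$, transition function $\delta:Q\times X\to Q$ and output function $\lambda:Q\times X\to X$; it is a finite state automaton if $Q$ is finite. Write $\lambda_q(x)=\lambda(q,x)$ and $\delta_x(q)=\delta(q,x)$. It is drawn as a labeled directed graph with edges $q\xrightarrow{x\,\mid\,\lambda_q(x)}\delta(q,x)$. It is invertible if $\lambda_q$ is a permutation of $X$ for each $q\in Q$; then the inverse automaton $\mathcal{A}^{-1}$ is obtained by switching input and output letters on all edge labels, i.e. it has an edge $q\xrightarrow{\lambda_q(x)\,\mid\, x}\delta(q,x)$ for all $q,x$. The dual automaton is $\partial\mathcal{A}=(X,Q,\lambda,\delta)$, i.e. the alphabet and states are interchanged and the output and transition functions are interchanged. An invertible automaton is reversible if its dual is invertible (equivalently, $\delta_x$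 is a permutation of $Q$ for each $x\in X$), and bireversible if it is reversible and additionally its inverse is reversible. Each $\lambda_q$ extends to finite words (and to infinite words, letter by letter) by $\lambda_q(x_0x_1\cdots x_n)=\lambda_q(x_0)\lambda_{\delta(q,x_0)}(x_1\cdots x_n)$. The group generated by an invertible finite state automaton is the group generated by the maps $\{\lambda_q: q\in Q\}$ (acting on the set of words over $X$) under composition.
   Formalization: The group A is assumed nontrivial; for trivial A the claim fails, since A ≀ Z is then the infinite group Z while an automaton with one letter and one state generates the trivial group. *)

theory Defs
  imports "HOL-Algebra.Algebra"
begin

section \<open>Mealy automata\<close>

record ('q, 'x) mealy =
  state_set :: "'q set"
  alphabet :: "'x set"
  next_state :: "'q \<Rightarrow> 'x \<Rightarrow> 'q"
  out_letter :: "'q \<Rightarrow> 'x \<Rightarrow> 'x"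

definition mealy_automaton :: "('q, 'x) mealy \<Rightarrow> bool" where
  "mealy_automaton M \<longleftrightarrow>
     finite (alphabet M) \<and>
     (\<forall>q\<in>state_set M. \<forall>x\<in>alphabet M. next_state M q x \<in> state_set M) \<and>
     (\<forall>q\<in>state_set M. \<forall>x\<in>alphabet M. out_letter M q x \<in> alphabet M)"

definition finite_state_automaton :: "('q, 'x) mealy \<Rightarrow> bool" where
  "finite_state_automaton M \<longleftrightarrow> mealy_automaton M \<and> finite (state_set M)"

definition invertible_automaton :: "('q, 'x) mealy \<Rightarrow> bool" where
  "invertible_automaton M \<longleftrightarrow> (\<forall>q\<in>state_set M. bij_betw (out_letter M q) (alphabet M) (alphabet M))"

text \<open>The edge from \<open>q\<close> labelled \<open>x | y\<close> becomes an edge labelled \<open>y | x\<close> with the same end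
  points, so reading \<open>y\<close> in state \<open>q\<close> means recovering the letter \<open>x\<close> that \<open>q\<close> maps to \<open>y\<close>.
  Only meaningful for invertible automata.\<close>

definition inverse_automaton :: "('q, 'x) mealy \<Rightarrow> ('q, 'x) mealy" where
  "inverse_automaton M =
     \<lparr>state_set = state_set M,
      alphabet = alphabet M,
      next_state = (\<lambda>q y. next_state M q (inv_into (alphabet M) (out_letter M q) y)),
      out_letter = (\<lambda>q y. inv_into (alphabet M) (out_letter M q) y)\<rparr>"

definition dual_automaton :: "('q, 'x) mealy \<Rightarrow> ('x, 'q) mealy" where
  "dual_automaton M =
     \<lparr>state_set = alphabet M,
      alphabet = state_set M,
      next_state = (\<lambda>x q. out_letter M q x),
      out_letter = (\<lambda>x q. next_state M q x)\<rparr>"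

definition reversible_automaton :: "('q, 'x) mealy \<Rightarrow> bool" where
  "reversible_automaton M \<longleftrightarrow> invertible_automaton M \<and> invertible_automaton (dual_automaton M)"

definition bireversible_automaton :: "('q, 'x) mealy \<Rightarrow> bool" where
  "bireversible_automaton M \<longleftrightarrow>
     reversible_automaton M \<and> reversible_automaton (inverse_automaton M)"

primrec word_map :: "('q, 'x) mealy \<Rightarrow> 'q \<Rightarrow> 'x list \<Rightarrow> 'x list" where
  "word_map M q [] = []"
| "word_map M q (x # xs) = out_letter M q x # word_map M (next_state M q x) xs"

text \<open>\<open>restrict\<close> is needed because the elements of \<open>BijGroup\<close> are extensional functions.
  \<open>subgroup_generated\<close> discards generators outside the carrier; for an invertible automaton
  there are none, by \<open>word_map_in_BijGroup\<close> below.\<close>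

definition automaton_group :: "('q, 'x) mealy \<Rightarrow> ('x list \<Rightarrow> 'x list) monoid" where
  "automaton_group M =
     subgroup_generated (BijGroup (lists (alphabet M)))
       ((\<lambda>q. restrict (word_map M q) (lists (alphabet M))) ` state_set M)"

lemma word_map_in_lists:
  assumes "mealy_automaton M" "q \<in> state_set M" "w \<in> lists (alphabet M)"
  shows "word_map M q w \<in> lists (alphabet M)"
  using assms(3,2)
  by (induction w arbitrary: q) (use assms(1) in \<open>auto simp: mealy_automaton_def\<close>)

lemma word_map_inverse:
  assumes "mealy_automaton M" "invertible_automaton M"
    and "q \<in> state_set M" "w \<in> lists (alphabet M)"
  shows "word_map (inverse_automaton M) q (word_map M q w) = w"
    and "word_map M q (word_map (inverse_automaton M) q w) = w"
    and "word_map (inverse_automaton M) q w \<in> lists (alphabet M)"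
proof -
  note d = assms(1,2)[unfolded mealy_automaton_def invertible_automaton_def]
  have 1: "inv_into (alphabet M) (out_letter M q) (out_letter M q x) = x"
    if "q \<in> state_set M" "x \<in> alphabet M" for q x
    using d that by (auto simp: bij_betw_inv_into_left)
  have 2: "out_letter M q (inv_into (alphabet M) (out_letter M q) x) = x"
    if "q \<in> state_set M" "x \<in> alphabet M" for q x
    using d that by (auto simp: bij_betw_inv_into_right)
  have 3: "inv_into (alphabet M) (out_letter M q) x \<in> alphabet M"
    if "q \<in> state_set M" "x \<in> alphabet M" for q x
    using d that by (auto simp: bij_betw_def intro: inv_into_into)
  show "word_map (inverse_automaton M) q (word_map M q w) = w"
    using assms(4,3)
    by (induction w arbitrary: q) (use d 1 in \<open>auto simp: inverse_automaton_def\<close>)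
  show "word_map M q (word_map (inverse_automaton M) q w) = w"
    using assms(4,3)
    by (induction w arbitrary: q) (use d 2 3 in \<open>auto simp: inverse_automaton_def\<close>)
  show "word_map (inverse_automaton M) q w \<in> lists (alphabet M)"
    using assms(4,3)
    by (induction w arbitrary: q) (use d 3 in \<open>auto simp: inverse_automaton_def\<close>)
qed

lemma word_map_in_BijGroup:
  assumes "mealy_automaton M" "invertible_automaton M" "q \<in> state_set M"
  shows "restrict (word_map M q) (lists (alphabet M)) \<in> carrier (BijGroup (lists (alphabet M)))"
proof -
  have "bij_betw (word_map M q) (lists (alphabet M)) (lists (alphabet M))"
    by (rule bij_betw_byWitness[where f' = "word_map (inverse_automaton M) q"])
       (use word_map_inverse[OF assms] word_map_in_lists[OF assms(1,3)] in \<open>simp_all add: image_subset_iff\<close>)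
  then show ?thesis
    by (simp add: BijGroup_def Bij_def)
qed


section \<open>The restricted wreath product with the integers\<close>

definition semidirect_product ::
    "('n, 'c) monoid_scheme \<Rightarrow> ('h, 'd) monoid_scheme \<Rightarrow> ('h \<Rightarrow> 'n \<Rightarrow> 'n) \<Rightarrow> ('n \<times> 'h) monoid" where
  "semidirect_product N H \<phi> =
     \<lparr>carrier = carrier N \<times> carrier H,
      monoid.mult = (\<lambda>(n, h) (n', h'). (n \<otimes>\<^bsub>N\<^esub> \<phi> h n', h \<otimes>\<^bsub>H\<^esub> h')),
      one = (\<one>\<^bsub>N\<^esub>, \<one>\<^bsub>H\<^esub>)\<rparr>"

definition shift :: "int \<Rightarrow> (int \<Rightarrow> 'a) \<Rightarrow> int \<Rightarrow> 'a" where
  "shift k f = (\<lambda>i. f (i - k))"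

definition wreath_int :: "('a, 'c) monoid_scheme \<Rightarrow> ((int \<Rightarrow> 'a) \<times> int) monoid" where
  "wreath_int A = semidirect_product (sum_group UNIV (\<lambda>_. A)) integer_group shift"

lemma shift_in_carrier:
  assumes "group A" "f \<in> carrier (sum_group UNIV (\<lambda>_::int. A))"
  shows "shift k f \<in> carrier (sum_group UNIV (\<lambda>_::int. A))"
proof -
  have "{i. shift k f i \<noteq> \<one>\<^bsub>A\<^esub>} = (\<lambda>i. i + k) ` {i. f i \<noteq> \<one>\<^bsub>A\<^esub>}"
  proof (intro equalityI subsetI)
    fix i assume "i \<in> {i. shift k f i \<noteq> \<one>\<^bsub>A\<^esub>}"
    then show "i \<in> (\<lambda>i. i + k) ` {i. f i \<noteq> \<one>\<^bsub>A\<^esub>}"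
      by (intro image_eqI[of _ _ "i - k"]) (auto simp: shift_def)
  qed (auto simp: shift_def)
  then show ?thesis
    using assms by (auto simp: carrier_sum_group shift_def)
qed

lemma group_wreath_int:
  assumes "group A"
  shows "group (wreath_int A)"
proof -
  define N where "N = sum_group UNIV (\<lambda>_::int. A)"
  interpret N: group N by (simp add: N_def assms)
  have m: "f \<otimes>\<^bsub>N\<^esub> g = (\<lambda>i. f i \<otimes>\<^bsub>A\<^esub> g i)" for f g
    by (simp add: N_def sum_group_def restrict_def)
  have shm: "shift k (f \<otimes>\<^bsub>N\<^esub> g) = shift k f \<otimes>\<^bsub>N\<^esub> shift k g" for k f g
    by (simp add: m shift_def)
  have sh1: "shift k \<one>\<^bsub>N\<^esub> = \<one>\<^bsub>N\<^esub>" for k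
    by (simp add: N_def sum_group_def shift_def restrict_def)
  have shs: "shift k (shift l f) = shift (k + l) f" "shift 0 f = f" for k l and f :: "int \<Rightarrow> 'a"
    by (simp_all add: shift_def diff_diff_eq)
  have cl: "shift k f \<in> carrier N" if "f \<in> carrier N" for k f
    using shift_in_carrier[OF assms] that by (simp add: N_def)
  show ?thesis
    unfolding wreath_int_def semidirect_product_def N_def[symmetric]
  proof (rule groupI; clarsimp simp: cl shm sh1 shs N.m_assoc add.assoc)
    fix f k assume f: "f \<in> carrier N"
    show "\<exists>g\<in>carrier N. \<exists>l. g \<otimes>\<^bsub>N\<^esub> shift l f = \<one>\<^bsub>N\<^esub> \<and> l + k = 0"
      using cl[OF f, of "- k"]
      by (intro bexI[of _ "inv\<^bsub>N\<^esub> (shift (- k) f)"] exI[of _ "- k"]) auto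
  qed
qed

end

theory Submission
  imports Defs
begin

text \<open>
  The theorem follows from the existence of an automorphism \<open>\<beta>\<close> of \<open>A\<close> whose only fixed point is
  the identity. Such a \<open>\<beta>\<close> yields an automaton with state set and alphabet \<open>A\<close> which in state
  \<open>q\<close> maps the letter \<open>x\<close> to \<open>q x\<close> and moves to state \<open>q \<beta>(x)\<close>. It is invertible because left
  multiplication is bijective, and reversible for the same reason. In its inverse, the letter \<open>y\<close>
  takes \<open>q\<close> to \<open>q \<beta>(q)\<^sup>-\<^sup>1 \<beta>(y)\<close>, and \<open>q \<mapsto> q \<beta>(q)\<^sup>-\<^sup>1\<close> is bijective exactly because \<open>\<beta>\<close> has no
  nontrivial fixed point; this is bireversibility.

  To identify the group, write \<open>A\<close> additively and encode an infinite word \<open>x\<^sub>0 x\<^sub>1 \<dots>\<close> as the power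
  series \<open>f = \<Sum>i. x\<^sub>i t\<^sup>i\<close>. State \<open>q\<close> then acts by \<open>f \<mapsto> u f + q / (1 - t)\<close> with
  \<open>u = 1 + \<beta> t / (1 - t)\<close>. Let \<open>L\<^sub>q\<close> be this map. The map \<open>L\<^sub>q L\<^sub>0\<^sup>-\<^sup>1\<close> is the translation
  by \<open>q / (1 - t)\<close>, and conjugation by \<open>L\<^sub>0\<close> turns the translation by \<open>s\<close> into the translation by
  \<open>u s\<close>. So the group is generated by an abelian group of translations, on which \<open>L\<^sub>0\<close> acts by
  multiplication by \<open>u\<close>, and it is the wreath product as soon as \<open>\<Sum>k. u\<^sup>k q\<^sub>k / (1 - t) = 0\<close>
  forces all \<open>q\<^sub>k\<close> to vanish. The sequence operator \<open>\<Delta> s = (s\<^sub>n\<^sub>+\<^sub>1 - s\<^sub>n)\<^sub>n\<close> shows this: it satisfies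
  \<open>\<Delta> (u s) = \<Delta> s + \<beta> s\<close> and annihilates constants, so \<open>\<Delta>\<^sup>n\<close> annihilates \<open>u\<^sup>k q / (1 - t)\<close> for
  \<open>k < n\<close> and sends \<open>u\<^sup>n q / (1 - t)\<close> to the constant sequence \<open>\<beta>\<^sup>n q\<close>
  (\<open>difference_outputs_triangular\<close>). Injectivity of \<open>\<beta>\<close> then kills the coefficient with the highest
  index. The group-theoretic half of the argument is \<open>wreath_int_iso\<close>.

  It remains to find \<open>\<beta>\<close>. Inversion has no nontrivial fixed point on an abelian group of odd
  order. On a power \<open>B\<^sup>n\<close> of an abelian group with \<open>n \<ge> 2\<close>, take the companion matrix of
  \<open>p = x\<^sup>n - x + 1\<close>: since \<open>p(0) = p(1) = 1\<close>, both \<open>\<beta>\<close> and \<open>1 - \<beta>\<close> are invertible whatever \<open>B\<close>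
  is, because \<open>p(\<beta>) = 0\<close> makes each of them divide a unit. Applying this to each homocyclic summand \<open>(\<int>/2\<^sup>i)\<^bsup>a i\<^esup>\<close>, where \<open>a i \<noteq> 1\<close> by assumption, and
  combining the summands componentwise gives \<open>\<beta>\<close> on \<open>A\<close>.
\<close>

section \<open>Fixed-point-free endomorphisms\<close>

text \<open>Injectivity is the form in which bijectivity is easiest to verify and to transport; on a
  finite group the two agree.\<close>
definition fixed_point_free :: "('a, 'b) monoid_scheme \<Rightarrow> ('a \<Rightarrow> 'a) \<Rightarrow> bool" where
  "fixed_point_free G \<beta> \<longleftrightarrow>
     \<beta> \<in> hom G G \<and> inj_on \<beta> (carrier G) \<and> (\<forall>x\<in>carrier G. \<beta> x = x \<longrightarrow> x = \<one>\<^bsub>G\<^esub>)"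

lemma fixed_point_free_is_iso:
  assumes "group G" "group H" "G \<cong> H" and \<beta>: "fixed_point_free H \<beta>"
  shows "\<exists>\<gamma>. fixed_point_free G \<gamma>"
proof -
  interpret G: group G by fact
  interpret H: group H by fact
  obtain \<phi> where \<phi>: "\<phi> \<in> iso G H" using \<open>G \<cong> H\<close> by (auto simp: is_iso_def)
  define \<psi> where "\<psi> = inv_into (carrier G) \<phi>"
  have \<psi>: "\<psi> \<in> iso H G" unfolding \<psi>_def by (rule G.iso_set_sym[OF \<phi>])
  have \<phi>c: "\<phi> x \<in> carrier H" if "x \<in> carrier G" for x
    using \<phi> that by (auto simp: iso_def hom_def)
  have \<beta>c: "\<beta> x \<in> carrier H" if "x \<in> carrier H" for x
    using \<beta> that by (auto simp: fixed_point_free_def hom_def)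
  have \<phi>\<psi>: "\<phi> (\<psi> y) = y" if "y \<in> carrier H" for y
    unfolding \<psi>_def using \<phi> that by (auto simp: iso_def bij_betw_inv_into_right)
  have "fixed_point_free G (\<psi> \<circ> \<beta> \<circ> \<phi>)"
    unfolding fixed_point_free_def
  proof (intro conjI ballI impI)
    show "\<psi> \<circ> \<beta> \<circ> \<phi> \<in> hom G G"
      using \<phi> \<psi> \<beta> by (intro Group.hom_compose[of _ _ H]) (auto simp: iso_def fixed_point_free_def)
    show "inj_on (\<psi> \<circ> \<beta> \<circ> \<phi>) (carrier G)"
    proof (rule inj_onI)
      fix x y assume xy: "x \<in> carrier G" "y \<in> carrier G" "(\<psi> \<circ> \<beta> \<circ> \<phi>) x = (\<psi> \<circ> \<beta> \<circ> \<phi>) y"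
      then have "\<beta> (\<phi> x) = \<beta> (\<phi> y)" by (metis \<phi>\<psi> \<phi>c \<beta>c comp_apply)
      then have "\<phi> x = \<phi> y" using \<beta> \<phi>c xy by (auto simp: fixed_point_free_def inj_on_eq_iff)
      then show "x = y" using \<phi> xy by (auto simp: iso_def bij_betw_def inj_on_eq_iff)
    qed
    fix x assume x: "x \<in> carrier G" "(\<psi> \<circ> \<beta> \<circ> \<phi>) x = x"
    then have "\<beta> (\<phi> x) = \<phi> x" by (metis \<phi>\<psi> \<phi>c \<beta>c comp_apply)
    then have "\<phi> x = \<one>\<^bsub>H\<^esub>" using \<beta> \<phi>c x by (auto simp: fixed_point_free_def)
    also have "\<dots> = \<phi> \<one>\<^bsub>G\<^esub>" using \<phi> hom_one[OF _ G.is_group H.is_group, of \<phi>] by (simp add: iso_def)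
    finally show "x = \<one>\<^bsub>G\<^esub>" using \<phi> x by (auto simp: iso_def bij_betw_def inj_on_eq_iff)
  qed
  then show ?thesis by blast
qed

lemma fixed_point_free_DirProd:
  assumes "fixed_point_free G \<beta>" "fixed_point_free H \<gamma>"
  shows "fixed_point_free (G \<times>\<times> H) (map_prod \<beta> \<gamma>)"
  using assms
  by (auto simp: fixed_point_free_def hom_def intro!: map_prod_inj_on)

lemma fixed_point_free_sum_group:
  assumes "\<And>i. i \<in> I \<Longrightarrow> group (G i)" and \<beta>: "\<And>i. i \<in> I \<Longrightarrow> fixed_point_free (G i) (\<beta> i)"
  shows "fixed_point_free (sum_group I G) (\<lambda>x. \<lambda>i\<in>I. \<beta> i (x i))"
proof -
  have hom: "\<beta> i \<in> hom (G i) (G i)" if "i \<in> I" for i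
    using \<beta>[OF that] by (simp add: fixed_point_free_def)
  have one: "\<beta> i \<one>\<^bsub>G i\<^esub> = \<one>\<^bsub>G i\<^esub>" if "i \<in> I" for i
    using hom_one[OF hom assms(1) assms(1)] that by blast
  have C: "x \<in> carrier (sum_group I G) \<longleftrightarrow>
      x \<in> (\<Pi>\<^sub>E i\<in>I. carrier (G i)) \<and> finite {i \<in> I. x i \<noteq> \<one>\<^bsub>G i\<^esub>}" for x
    using assms(1) by (simp add: carrier_sum_group)
  show ?thesis
    unfolding fixed_point_free_def
  proof (intro conjI ballI impI homI)
    fix x assume x: "x \<in> carrier (sum_group I G)"
    have "{i \<in> I. (\<lambda>i\<in>I. \<beta> i (x i)) i \<noteq> \<one>\<^bsub>G i\<^esub>} \<subseteq> {i \<in> I. x i \<noteq> \<one>\<^bsub>G i\<^esub>}"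
      using one by auto
    moreover have "finite {i \<in> I. x i \<noteq> \<one>\<^bsub>G i\<^esub>}" using x by (simp only: C)
    ultimately have "finite {i \<in> I. (\<lambda>i\<in>I. \<beta> i (x i)) i \<noteq> \<one>\<^bsub>G i\<^esub>}"
      by (rule finite_subset)
    moreover have "(\<lambda>i\<in>I. \<beta> i (x i)) \<in> (\<Pi>\<^sub>E i\<in>I. carrier (G i))"
      using x hom by (force simp: C hom_def)
    ultimately show "(\<lambda>i\<in>I. \<beta> i (x i)) \<in> carrier (sum_group I G)"
      by (simp only: C)
  next
    fix x y assume "x \<in> carrier (sum_group I G)" "y \<in> carrier (sum_group I G)"
    then show "(\<lambda>i\<in>I. \<beta> i ((x \<otimes>\<^bsub>sum_group I G\<^esub> y) i)) =
        (\<lambda>i\<in>I. \<beta> i (x i)) \<otimes>\<^bsub>sum_group I G\<^esub> (\<lambda>i\<in>I. \<beta> i (y i))"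
      using hom by (force simp: C hom_def intro!: restrict_ext)
  next
    show "inj_on (\<lambda>x. \<lambda>i\<in>I. \<beta> i (x i)) (carrier (sum_group I G))"
    proof (rule inj_onI)
      fix x y
      assume xy: "x \<in> carrier (sum_group I G)" "y \<in> carrier (sum_group I G)"
        and eq: "(\<lambda>i\<in>I. \<beta> i (x i)) = (\<lambda>i\<in>I. \<beta> i (y i))"
      show "x = y"
      proof (rule PiE_ext[of _ I "\<lambda>i. carrier (G i)"])
        fix i assume i: "i \<in> I"
        then have "\<beta> i (x i) = \<beta> i (y i)" using fun_cong[OF eq, of i] by simp
        moreover have "x i \<in> carrier (G i)" "y i \<in> carrier (G i)" using xy i by (auto simp: C)
        ultimately show "x i = y i" using \<beta>[OF i] by (auto simp: fixed_point_free_def inj_on_eq_iff)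
      qed (use xy C in auto)
    qed
  next
    fix x assume x: "x \<in> carrier (sum_group I G)" and eq: "(\<lambda>i\<in>I. \<beta> i (x i)) = x"
    show "x = \<one>\<^bsub>sum_group I G\<^esub>"
      unfolding one_sum_group
    proof (rule extensionalityI[of _ I])
      fix i assume i: "i \<in> I"
      then have "\<beta> i (x i) = x i" using fun_cong[OF eq, of i] by simp
      then show "x i = (\<lambda>i\<in>I. \<one>\<^bsub>G i\<^esub>) i" using \<beta>[OF i] x i by (auto simp: fixed_point_free_def C)
    qed (use x in \<open>auto simp: C PiE_def\<close>)
  qed
qed

text \<open>A fixed point of inversion satisfies \<open>x\<^sup>2 = 1\<close>, so its order divides both 2 and the odd
  group order.\<close>
lemma (in comm_group) fixed_point_free_inv_odd_order:
  assumes "odd (order G)"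
  shows "fixed_point_free G (\<lambda>x. inv x)"
  unfolding fixed_point_free_def
proof (intro conjI ballI impI)
  show "(\<lambda>x. inv x) \<in> hom G G" by (auto simp: hom_def inv_mult)
  show "inj_on (\<lambda>x. inv x) (carrier G)" by (rule inj_onI) (metis inv_inv)
  fix x assume x: "x \<in> carrier G" "inv x = x"
  then have "x [^] (2::nat) = \<one>" using l_inv[of x] by (simp add: numeral_2_eq_2)
  then have "ord x dvd 2" using x pow_eq_id by blast
  moreover have "ord x dvd order G" using x by (intro ord_dvd_group_order)
  ultimately have "ord x = 1"
    using assms by (metis dvd_trans two_is_prime_nat prime_nat_iff)
  then show "x = \<one>" using x ord_eq_1 by blast
qed

text \<open>In additive notation, the companion matrix of \<open>x\<^sup>n - x + 1\<close>: it sends the basis vector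
  \<open>e\<^sub>i\<close> to \<open>e\<^sub>i\<^sub>+\<^sub>1\<close> for \<open>i < n\<close>, and \<open>e\<^sub>n\<close> to \<open>e\<^sub>2 - e\<^sub>1\<close>.\<close>
definition twisted_shift :: "('a, 'b) monoid_scheme \<Rightarrow> nat \<Rightarrow> (nat \<Rightarrow> 'a) \<Rightarrow> nat \<Rightarrow> 'a" where
  "twisted_shift G n v =
     (\<lambda>i\<in>{1..n}. if i = 1 then inv\<^bsub>G\<^esub> (v n) else if i = 2 then v 1 \<otimes>\<^bsub>G\<^esub> v n else v (i - 1))"

text \<open>The image of \<open>v\<close> determines \<open>v n\<close>, hence \<open>v 1\<close>, hence all other coordinates. If \<open>v\<close> is
  fixed, then \<open>v 2 = v 1 \<otimes> v n = inv (v n) \<otimes> v n\<close> is trivial, and the shift spreads this to the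
  coordinates above 2 and then to \<open>v 1 = inv (v n)\<close>. The second coordinate exists because
  \<open>n \<noteq> 1\<close>; for \<open>n = 0\<close> the power is trivial.\<close>
lemma (in comm_group) fixed_point_free_power:
  assumes "n \<noteq> 1"
  shows "fixed_point_free (sum_group {1..n} (\<lambda>_. G)) (twisted_shift G n)"
proof -
  let ?P = "sum_group {1..n} (\<lambda>_. G)"
  have C: "carrier ?P = {1..n} \<rightarrow>\<^sub>E carrier G"
    by (subst carrier_sum_group) auto
  show ?thesis
    unfolding fixed_point_free_def
  proof (intro conjI ballI impI homI)
    fix v assume "v \<in> carrier ?P"
    then have c: "i \<in> {1..n} \<Longrightarrow> v i \<in> carrier G" for i unfolding C by auto
    have "v (i - Suc 0) \<in> carrier G" if "Suc 0 \<le> i" "i \<noteq> Suc 0" "i \<le> n" for i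
      using that by (intro c) auto
    with c show "twisted_shift G n v \<in> carrier ?P"
      unfolding C using assms by (auto simp: twisted_shift_def PiE_iff)
  next
    fix v w assume vw: "v \<in> carrier ?P" "w \<in> carrier ?P"
    show "twisted_shift G n (v \<otimes>\<^bsub>?P\<^esub> w) = twisted_shift G n v \<otimes>\<^bsub>?P\<^esub> twisted_shift G n w"
      unfolding mult_sum_group
    proof (rule extensionalityI[of _ "{1..n}"])
      have c: "i \<in> {1..n} \<Longrightarrow> v i \<in> carrier G \<and> w i \<in> carrier G" for i
        using vw unfolding C by auto
      have p: "v (i - Suc 0) \<in> carrier G \<and> w (i - Suc 0) \<in> carrier G"
        if "Suc 0 \<le> i" "i \<noteq> Suc 0" "i \<le> n" for i
        using that by (intro c) auto
      fix i assume "i \<in> {1..n}"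
      then show "twisted_shift G n (\<lambda>i\<in>{1..n}. v i \<otimes> w i) i =
          (\<lambda>i\<in>{1..n}. twisted_shift G n v i \<otimes> twisted_shift G n w i) i"
        using assms c p by (auto simp: twisted_shift_def inv_mult m_ac)
    qed (auto simp: twisted_shift_def)
  next
    show "inj_on (twisted_shift G n) (carrier ?P)"
    proof (rule inj_onI)
      fix v w assume vw: "v \<in> carrier ?P" "w \<in> carrier ?P"
        and eq: "twisted_shift G n v = twisted_shift G n w"
      have e: "i \<in> {1..n} \<Longrightarrow> twisted_shift G n v i = twisted_shift G n w i" for i
        using eq by simp
      have c: "i \<in> {1..n} \<Longrightarrow> v i \<in> carrier G \<and> w i \<in> carrier G" for i
        using vw unfolding C by auto
      show "v = w"
      proof (rule PiE_ext[of _ "{1..n}" "\<lambda>_. carrier G"])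
        fix i assume i: "i \<in> {1..n}"
        then have n: "n \<ge> 2" using assms by auto
        have last: "v n = w n" using e[of 1] c[of n] n by (simp add: twisted_shift_def) (metis inv_inv)
        have first: "v 1 = w 1" using e[of 2] last c[of n] c[of 1] n
          by (simp add: twisted_shift_def)
        consider "i = 1" | "i = n" | "i \<noteq> 1" "i < n" using i by fastforce
        then show "v i = w i"
          using e[of "Suc i"] last first i by cases (auto simp: twisted_shift_def)
      qed (use vw in \<open>simp_all only: C\<close>)
    qed
  next
    fix v assume v: "v \<in> carrier ?P" and eq: "twisted_shift G n v = v"
    have e: "i \<in> {1..n} \<Longrightarrow> v i = twisted_shift G n v i" for i using eq by simp
    have c: "i \<in> {1..n} \<Longrightarrow> v i \<in> carrier G" for i using v unfolding C by auto
    have "v i = \<one>" if i: "i \<in> {1..n}" for i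
    proof -
      have n: "n \<ge> 2" using i assms by auto
      have first: "v 1 = inv (v n)" using e[of 1] n by (simp add: twisted_shift_def)
      have second: "v 2 = \<one>"
        using e[of 2] n c[of n] first by (simp add: twisted_shift_def)
      have "j \<le> n \<longrightarrow> v j = \<one>" if "j \<ge> 2" for j
        using that by (induction j rule: nat_induct_at_least)
          (use second e in \<open>auto simp: twisted_shift_def\<close>)
      then have "v n = \<one>" "i \<ge> 2 \<Longrightarrow> v i = \<one>" using n i by auto
      then show ?thesis using first i by (cases "i = 1") auto
    qed
    then show "v = \<one>\<^bsub>?P\<^esub>"
      using v unfolding one_sum_group by (intro extensionalityI[of _ "{1..n}"]) (auto simp: C[simplified] PiE_def)
  qed
qed

text \<open>Inversion is an endomorphism of the odd-order factor only once that factor is known to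
  inherit commutativity from the product.\<close>
lemma DirProd_comm_imp_left_comm:
  assumes "group G" "group H" "comm_group (G \<times>\<times> H)"
  shows "comm_group G"
proof -
  interpret G: group G by fact
  interpret H: group H by fact
  interpret GH: comm_group "G \<times>\<times> H" by fact
  show ?thesis
    by (rule G.group_comm_groupI) (use GH.m_comm[of "(_, \<one>\<^bsub>H\<^esub>)" "(_, \<one>\<^bsub>H\<^esub>)"] in auto)
qed

section \<open>Recognising the restricted wreath product with the integers\<close>

lemma hom_finprod_comm_group:
  assumes "comm_group N" "comm_group H" and h: "h \<in> hom N H"
    and f: "f \<in> S \<rightarrow> carrier N"
  shows "h (finprod N f S) = finprod H (\<lambda>i. h (f i)) S"
proof -
  interpret N: comm_group N by fact
  interpret H: comm_group H by fact
  interpret h: group_hom N H h by unfold_locales (rule h)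
  show ?thesis using f
  proof (induction S rule: infinite_finite_induct)
    case (insert x F)
    then have "(\<lambda>i. h (f i)) \<in> F \<rightarrow> carrier H" "h (f x) \<in> carrier H"
      "f \<in> F \<rightarrow> carrier N" "f x \<in> carrier N"
      by (auto simp: Pi_iff)
    with insert show ?case by simp
  qed auto
qed

text \<open>
  A lamplighter group is generated by the elements \<open>\<tau> a \<otimes> u\<close>, where \<open>u\<close> moves the lamplighter
  and \<open>\<tau> a\<close> changes the lamp at the origin; the conjugate of \<open>\<tau> a\<close> by \<open>u [^] k\<close> changes the lamp
  at position \<open>k\<close>. Lamps at different positions have to be independent. The homomorphisms \<open>\<theta> n\<close>
  certify this in triangular form: \<open>\<theta> n\<close> ignores the lamps at positions \<open>0, \<dots>, n - 1\<close> and detects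
  the lamp at position \<open>n\<close>.
\<close>
locale lamplighter_frame = group G + A: comm_group A
  for G :: "('g, 'b) monoid_scheme" (structure) and A :: "('a, 'c) monoid_scheme" +
  fixes N :: "'g set" and u :: 'g and \<tau> :: "'a \<Rightarrow> 'g" and \<theta> :: "nat \<Rightarrow> 'g \<Rightarrow> 'a"
  assumes N_subgroup: "subgroup N G"
    and N_commute: "x \<in> N \<Longrightarrow> y \<in> N \<Longrightarrow> x \<otimes> y = y \<otimes> x"
    and u_closed: "u \<in> carrier G"
    and u_normalises: "x \<in> N \<Longrightarrow> u \<otimes> x \<otimes> inv u \<in> N" "x \<in> N \<Longrightarrow> inv u \<otimes> x \<otimes> u \<in> N"
    and \<tau>_hom: "\<tau> \<in> hom A (G\<lparr>carrier := N\<rparr>)"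
    and generates: "subgroup H G \<Longrightarrow> (\<And>a. a \<in> carrier A \<Longrightarrow> \<tau> a \<otimes> u \<in> H) \<Longrightarrow> carrier G \<subseteq> H"
    and \<theta>_hom: "\<theta> n \<in> hom (G\<lparr>carrier := N\<rparr>) A"
    and \<theta>_below: "k < n \<Longrightarrow> a \<in> carrier A \<Longrightarrow> \<theta> n (u [^] k \<otimes> \<tau> a \<otimes> inv (u [^] k)) = \<one>\<^bsub>A\<^esub>"
    and \<theta>_diagonal: "a \<in> carrier A \<Longrightarrow> \<theta> n (u [^] n \<otimes> \<tau> a \<otimes> inv (u [^] n)) = \<one>\<^bsub>A\<^esub> \<Longrightarrow> a = \<one>\<^bsub>A\<^esub>"
    and A_nontrivial: "\<exists>a\<in>carrier A. a \<noteq> \<one>\<^bsub>A\<^esub>"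
begin

abbreviation "N_group \<equiv> G\<lparr>carrier := N\<rparr>"

definition conj_u :: "int \<Rightarrow> 'g \<Rightarrow> 'g" where
  "conj_u k x = u [^] k \<otimes> x \<otimes> inv (u [^] k)"

text \<open>The configuration \<open>f\<close> of lamps as an element of \<open>G\<close>. The product is restricted to the
  support because products over infinite index sets are trivial by convention.\<close>
definition lamp_product :: "(int \<Rightarrow> 'a) \<Rightarrow> 'g" where
  "lamp_product f = finprod N_group (\<lambda>i. conj_u i (\<tau> (f i))) {i. f i \<noteq> \<one>\<^bsub>A\<^esub>}"

lemma N_closed: "x \<in> N \<Longrightarrow> x \<in> carrier G"
  using N_subgroup subgroup.subset by blast

lemma comm_group_N: "comm_group N_group"
proof -
  interpret N: group N_group using N_subgroup by (rule subgroup.subgroup_is_group) (rule group_axioms)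
  show ?thesis by (rule N.group_comm_groupI) (simp add: N_commute)
qed

sublocale N: comm_group N_group by (rule comm_group_N)

lemma \<tau>_in_N: "a \<in> carrier A \<Longrightarrow> \<tau> a \<in> N"
  using \<tau>_hom by (auto simp: hom_def)

lemma conj_u_add:
  assumes "x \<in> carrier G" shows "conj_u (k + l) x = conj_u k (conj_u l x)"
  using assms u_closed by (simp add: conj_u_def int_pow_mult inv_mult_group m_assoc)

lemma conj_u_mult:
  assumes "x \<in> carrier G" "y \<in> carrier G"
  shows "conj_u k (x \<otimes> y) = conj_u k x \<otimes> conj_u k y"
proof -
  have "conj_u k x \<otimes> conj_u k y = u [^] k \<otimes> x \<otimes> (inv (u [^] k) \<otimes> u [^] k) \<otimes> y \<otimes> inv (u [^] k)"
    unfolding conj_u_def using assms u_closed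
    by (metis (no_types, opaque_lifting) int_pow_closed inv_closed m_assoc m_closed)
  then show ?thesis using assms u_closed by (simp add: conj_u_def m_assoc)
qed

lemma conj_u_in_N: assumes "x \<in> N" shows "conj_u k x \<in> N"
proof (induction k rule: int_induct[of _ 0])
  case base
  show ?case using assms N_closed by (simp add: conj_u_def)
next
  case (step1 i)
  have "conj_u (i + 1) x = u \<otimes> conj_u i x \<otimes> inv u"
    using conj_u_add[of x 1 i] assms N_closed u_closed by (simp add: add.commute conj_u_def)
  then show ?case using u_normalises(1) step1 by simp
next
  case (step2 i)
  have "conj_u (i - 1) x = inv u \<otimes> conj_u i x \<otimes> u"
    using conj_u_add[of x "-1" i] assms N_closed u_closed
    by (simp add: conj_u_def int_pow_neg)
  then show ?case using u_normalises(2) step2 by simp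
qed

lemma conj_u_hom: "conj_u k \<in> hom N_group N_group"
  using conj_u_in_N conj_u_mult N_closed by (auto simp: hom_def)

lemma u_pow_commute: "x \<in> carrier G \<Longrightarrow> u [^] k \<otimes> x = conj_u k x \<otimes> u [^] (k::int)"
  using u_closed by (simp add: conj_u_def m_assoc)

text \<open>Enlarging the index set makes products of two configurations with different supports
  comparable.\<close>
lemma lamp_product_eq_finprod:
  assumes "f \<in> UNIV \<rightarrow> carrier A" "finite S" "{i. f i \<noteq> \<one>\<^bsub>A\<^esub>} \<subseteq> S"
  shows "lamp_product f = finprod N_group (\<lambda>i. conj_u i (\<tau> (f i))) S"
proof -
  have one: "conj_u i (\<tau> \<one>\<^bsub>A\<^esub>) = \<one>" for i
    using hom_one[OF \<tau>_hom A.is_group N.is_group] u_closed by (simp add: conj_u_def)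
  have c: "f i \<in> carrier A" for i using assms(1) by blast
  show ?thesis
    unfolding lamp_product_def
    by (rule N.finprod_mono_neutral_cong_left) (use assms(2,3) c conj_u_in_N \<tau>_in_N one in auto)
qed

lemma lamp_product_in_N:
  assumes "f \<in> UNIV \<rightarrow> carrier A" shows "lamp_product f \<in> N"
proof -
  have "(\<lambda>i. conj_u i (\<tau> (f i))) \<in> {i. f i \<noteq> \<one>\<^bsub>A\<^esub>} \<rightarrow> carrier N_group"
    using assms conj_u_in_N \<tau>_in_N by auto
  from N.finprod_closed[OF this] show ?thesis by (simp add: lamp_product_def)
qed

abbreviation "lamps \<equiv> sum_group UNIV (\<lambda>_::int. A)"

lemma lampsD:
  assumes "f \<in> carrier lamps"
  shows "f \<in> UNIV \<rightarrow> carrier A" "finite {i. f i \<noteq> \<one>\<^bsub>A\<^esub>}"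
  using assms A.is_group by (auto simp: carrier_sum_group)

lemma lamp_product_hom: "lamp_product \<in> hom lamps N_group"
proof (rule homI)
  fix f g assume f: "f \<in> carrier lamps" and g: "g \<in> carrier lamps"
  have fg: "f \<otimes>\<^bsub>lamps\<^esub> g \<in> carrier lamps"
    using f g A.is_group by (simp add: group.is_monoid monoid.m_closed del: mult_sum_group)
  let ?S = "{i. f i \<noteq> \<one>\<^bsub>A\<^esub>} \<union> {i. g i \<noteq> \<one>\<^bsub>A\<^esub>}"
  have S: "finite ?S" using lampsD f g by blast
  have c: "f i \<in> carrier A" "g i \<in> carrier A" for i using lampsD f g by blast+
  have t: "conj_u i (\<tau> (f i \<otimes>\<^bsub>A\<^esub> g i)) = conj_u i (\<tau> (f i)) \<otimes> conj_u i (\<tau> (g i))" for i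
    using \<tau>_hom c by (simp add: hom_def conj_u_mult \<tau>_in_N N_closed)
  have "lamp_product (f \<otimes>\<^bsub>lamps\<^esub> g) = finprod N_group (\<lambda>i. conj_u i (\<tau> ((f \<otimes>\<^bsub>lamps\<^esub> g) i))) ?S"
    using lampsD[OF fg] S by (intro lamp_product_eq_finprod) auto
  also have "\<dots> = finprod N_group (\<lambda>i. conj_u i (\<tau> (f i)) \<otimes>\<^bsub>N_group\<^esub> conj_u i (\<tau> (g i))) ?S"
    by (simp add: t)
  also have "\<dots> = lamp_product f \<otimes>\<^bsub>N_group\<^esub> lamp_product g"
    using lampsD f g S conj_u_in_N \<tau>_in_N c
    by (subst N.finprod_multf) (auto simp: lamp_product_eq_finprod[where S="?S"])
  finally show "lamp_product (f \<otimes>\<^bsub>lamps\<^esub> g) = lamp_product f \<otimes>\<^bsub>N_group\<^esub> lamp_product g" .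
qed (use lamp_product_in_N lampsD in auto)

text \<open>Moving the lamplighter by \<open>k\<close> shifts the whole configuration: this matches conjugation in
  \<open>G\<close> with the action that defines the wreath product.\<close>
lemma conj_u_lamp_product:
  assumes f: "f \<in> carrier lamps"
  shows "conj_u k (lamp_product f) = lamp_product (shift k f)"
proof -
  let ?S = "{i. f i \<noteq> \<one>\<^bsub>A\<^esub>}"
  have c: "f i \<in> carrier A" for i using lampsD f by blast
  have "conj_u k (lamp_product f) = finprod N_group (\<lambda>i. conj_u k (conj_u i (\<tau> (f i)))) ?S"
    unfolding lamp_product_def
    by (rule hom_finprod_comm_group[OF comm_group_N comm_group_N conj_u_hom])
       (use c conj_u_in_N \<tau>_in_N in auto)
  also have "\<dots> = finprod N_group (\<lambda>i. conj_u (i + k) (\<tau> (shift k f (i + k)))) ?S"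
    using c \<tau>_in_N N_closed by (simp add: conj_u_add[symmetric] shift_def add.commute)
  also have "\<dots> = finprod N_group (\<lambda>i. conj_u i (\<tau> (shift k f i))) ((\<lambda>i. i + k) ` ?S)"
    by (rule N.finprod_reindex[symmetric]) (use c conj_u_in_N \<tau>_in_N in \<open>auto simp: shift_def\<close>)
  also have "\<dots> = lamp_product (shift k f)"
  proof (rule lamp_product_eq_finprod[symmetric])
    show "{i. shift k f i \<noteq> \<one>\<^bsub>A\<^esub>} \<subseteq> (\<lambda>i. i + k) ` ?S"
    proof
      fix i assume "i \<in> {i. shift k f i \<noteq> \<one>\<^bsub>A\<^esub>}"
      then show "i \<in> (\<lambda>i. i + k) ` ?S"
        by (intro image_eqI[of _ _ "i - k"]) (auto simp: shift_def)
    qed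
  qed (use c lampsD[OF f] in \<open>auto simp: shift_def\<close>)
  finally show ?thesis .
qed

text \<open>Translate a nontrivial configuration by conjugation so that the lowest lamp that is on sits
  at position 0, and let \<open>n\<close> be the position of the highest one. Then \<open>\<theta> n\<close> sees only that highest
  lamp, which must therefore be off.\<close>
lemma lamp_product_kernel:
  assumes f: "f \<in> carrier lamps" and 1: "lamp_product f = \<one>"
  shows "f i = \<one>\<^bsub>A\<^esub>"
proof (rule ccontr)
  assume i: "f i \<noteq> \<one>\<^bsub>A\<^esub>"
  define S where "S = {i. f i \<noteq> \<one>\<^bsub>A\<^esub>}"
  have S: "finite S" "S \<noteq> {}" using i lampsD[OF f] by (auto simp: S_def)
  define m where "m = Min S"
  define n where "n = nat (Max S - m)"
  define g where "g = shift (- m) f"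
  have n: "int n = Max S - m" using S by (simp add: n_def m_def)
  have gc: "g j \<in> carrier A" for j using lampsD[OF f] by (auto simp: g_def shift_def)
  have supp: "{j. g j \<noteq> \<one>\<^bsub>A\<^esub>} \<subseteq> int ` {..n}"
  proof -
    have "j \<in> int ` {..n}" if "g j \<noteq> \<one>\<^bsub>A\<^esub>" for j
    proof -
      have "j + m \<in> S" using that by (simp add: g_def shift_def S_def)
      then have "m \<le> j + m" "j + m \<le> Max S"
        using Min_le[OF S(1)] Max_ge[OF S(1)] unfolding m_def by blast+
      then have "0 \<le> j" "j \<le> int n" using n by auto
      then show ?thesis by (intro image_eqI[of _ _ "nat j"]) auto
    qed
    then show ?thesis by auto
  qed
  have top: "g (int n) \<noteq> \<one>\<^bsub>A\<^esub>"
    using Max_in[OF S] n by (simp add: g_def shift_def) (simp add: S_def)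
  let ?t = "\<lambda>k. u [^] k \<otimes> \<tau> (g (int k)) \<otimes> inv (u [^] k)"
  have t: "conj_u (int k) (\<tau> (g (int k))) = ?t k" for k
    by (simp add: conj_u_def int_pow_int)
  have tN: "?t k \<in> N" for k using conj_u_in_N[OF \<tau>_in_N[OF gc]] by (simp flip: t)
  have "lamp_product g = conj_u (- m) \<one>" using conj_u_lamp_product[OF f, of "- m"] 1 by (simp add: g_def)
  then have "\<one> = lamp_product g" using u_closed by (simp add: conj_u_def)
  also have "\<dots> = finprod N_group (\<lambda>i. conj_u i (\<tau> (g i))) (int ` {..n})"
    by (rule lamp_product_eq_finprod) (use gc supp in auto)
  also have "\<dots> = finprod N_group ?t {..n}"
    by (subst N.finprod_reindex) (use gc conj_u_in_N \<tau>_in_N in \<open>auto simp: t\<close>)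
  finally have "\<theta> n \<one> = finprod A (\<lambda>k. \<theta> n (?t k)) {..n}"
    using tN by (simp add: hom_finprod_comm_group[OF comm_group_N A.comm_group_axioms \<theta>_hom])
  also have "\<dots> = finprod A (\<lambda>k. if k = n then \<theta> n (?t n) else \<one>\<^bsub>A\<^esub>) {..n}"
    by (rule A.finprod_cong') (use gc \<theta>_below \<theta>_hom[of n] tN in \<open>auto simp: hom_def\<close>)
  also have "\<dots> = \<theta> n (?t n)"
    using \<theta>_hom[of n] tN[of n]
    by (subst eq_commute, subst A.finprod_singleton_swap) (auto simp: hom_def)
  finally have "\<theta> n (?t n) = \<one>\<^bsub>A\<^esub>"
    using hom_one[OF \<theta>_hom N.is_group A.is_group] by simp
  with \<theta>_diagonal[OF gc] top show False by blast
qed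

lemma lamp_product_inj: "inj_on lamp_product (carrier lamps)"
proof -
  interpret lamp_product: group_hom lamps N_group lamp_product
    by (intro group_hom.intro group_hom_axioms.intro sum_group A.is_group N.is_group lamp_product_hom)
  have "f = \<one>\<^bsub>lamps\<^esub>" if "f \<in> carrier lamps" "lamp_product f = \<one>" for f
    using lamp_product_kernel[OF that] by (simp add: fun_eq_iff)
  then show ?thesis by (simp add: lamp_product.inj_on_one_iff)
qed

definition wreath_map :: "(int \<Rightarrow> 'a) \<times> int \<Rightarrow> 'g" where
  "wreath_map = (\<lambda>(f, k). lamp_product f \<otimes> u [^] k)"

lemma carrier_wreath: "carrier (wreath_int A) = carrier lamps \<times> UNIV"
  by (simp add: wreath_int_def semidirect_product_def)

lemma mult_wreath: "(f, k) \<otimes>\<^bsub>wreath_int A\<^esub> (g, l) = (f \<otimes>\<^bsub>lamps\<^esub> shift k g, k + l)"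
  by (simp add: wreath_int_def semidirect_product_def del: mult_sum_group)

lemma wreath_map_hom: "wreath_map \<in> hom (wreath_int A) G"
proof (rule homI; clarsimp simp only: carrier_wreath mem_Times_iff mult_wreath split_paired_all fst_conv snd_conv)
  fix f :: "int \<Rightarrow> 'a" and k :: int assume "f \<in> carrier lamps"
  then show "wreath_map (f, k) \<in> carrier G"
    using lamp_product_in_N lampsD N_closed u_closed by (auto simp: wreath_map_def)
next
  fix f g :: "int \<Rightarrow> 'a" and k l :: int
  assume f: "f \<in> carrier lamps" and g: "g \<in> carrier lamps"
  have c: "lamp_product f \<in> carrier G" "lamp_product g \<in> carrier G" "lamp_product (shift k g) \<in> carrier G"
    using f g lamp_product_in_N lampsD N_closed shift_in_carrier[OF A.is_group g] by auto
  have "lamp_product (f \<otimes>\<^bsub>lamps\<^esub> shift k g) = lamp_product f \<otimes> lamp_product (shift k g)"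
    using hom_mult[OF lamp_product_hom f shift_in_carrier[OF A.is_group g]] by simp
  then have "wreath_map (f \<otimes>\<^bsub>lamps\<^esub> shift k g, k + l) = lamp_product f \<otimes> (lamp_product (shift k g) \<otimes> u [^] k) \<otimes> u [^] l"
    using c u_closed by (simp add: wreath_map_def int_pow_mult m_assoc del: mult_sum_group)
  also have "\<dots> = lamp_product f \<otimes> (u [^] k \<otimes> lamp_product g) \<otimes> u [^] l"
    using u_pow_commute[OF c(2)] conj_u_lamp_product[OF g] by simp
  also have "\<dots> = wreath_map (f, k) \<otimes> wreath_map (g, l)"
    using c u_closed by (simp add: wreath_map_def m_assoc)
  finally show "wreath_map (f \<otimes>\<^bsub>lamps\<^esub> shift k g, k + l) = wreath_map (f, k) \<otimes> wreath_map (g, l)" .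
qed

lemma single_in_lamps: "a \<in> carrier A \<Longrightarrow> (\<lambda>i. if i = 0 then a else \<one>\<^bsub>A\<^esub>) \<in> carrier lamps"
  using A.is_group by (auto simp: carrier_sum_group)

text \<open>Injectivity on the pure configurations is \<open>lamp_product_kernel\<close>. If \<open>(f, k)\<close> is in the kernel,
  then \<open>u [^] k\<close> is the inverse of a configuration, so it commutes with all configurations. But for
  \<open>k \<noteq> 0\<close> it moves a single lamp at the origin to position \<open>k\<close>. Surjectivity only has to be
  checked on generators.\<close>
theorem wreath_int_iso: "G \<cong> wreath_int A"
proof -
  interpret W: group "wreath_int A" by (rule group_wreath_int) (rule A.is_group)
  interpret wreath_map: group_hom "wreath_int A" G wreath_map by unfold_locales (rule wreath_map_hom)
  have "(f, k) = \<one>\<^bsub>wreath_int A\<^esub>"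
    if f: "f \<in> carrier lamps" and 1: "wreath_map (f, k) = \<one>" for f k
  proof -
    have fN: "lamp_product f \<in> N" by (rule lamp_product_in_N[OF lampsD(1)[OF f]])
    have "inv (u [^] k) = lamp_product f"
      using 1 fN N_closed u_closed by (intro inv_equality) (auto simp: wreath_map_def)
    then have uk: "u [^] k = inv (lamp_product f)" using u_closed by (metis int_pow_closed inv_inv)
    then have ukN: "u [^] k \<in> N" using fN N_subgroup by (simp add: subgroup.m_inv_closed)
    have "k = 0"
    proof (rule ccontr)
      assume "k \<noteq> 0"
      obtain a where a: "a \<in> carrier A" "a \<noteq> \<one>\<^bsub>A\<^esub>" using A_nontrivial by blast
      let ?d = "\<lambda>i::int. if i = 0 then a else \<one>\<^bsub>A\<^esub>"
      have d: "?d \<in> carrier lamps" by (rule single_in_lamps) (rule a)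
      have dN: "lamp_product ?d \<in> N" by (rule lamp_product_in_N[OF lampsD(1)[OF d]])
      have "lamp_product (shift k ?d) = conj_u k (lamp_product ?d)" using conj_u_lamp_product[OF d] by simp
      also have "\<dots> = lamp_product ?d"
        unfolding conj_u_def using N_commute[OF ukN dN] dN N_closed u_closed
        by (simp add: m_assoc)
      finally have "shift k ?d = ?d"
        by (rule inj_onD[OF lamp_product_inj _ shift_in_carrier[OF A.is_group d] d])
      then have "shift k ?d 0 = ?d 0" by (rule fun_cong)
      with a \<open>k \<noteq> 0\<close> show False by (simp add: shift_def)
    qed
    moreover from this have "lamp_product f = \<one>" using 1 fN N_closed by (simp add: wreath_map_def)
    then have "f = (\<lambda>_. \<one>\<^bsub>A\<^esub>)" using lamp_product_kernel[OF f] by blast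
    ultimately show ?thesis by (simp add: wreath_int_def semidirect_product_def restrict_def integer_group_def)
  qed
  then have inj: "inj_on wreath_map (carrier (wreath_int A))"
    unfolding wreath_map.inj_on_one_iff by (auto simp: carrier_wreath)
  have "carrier G \<subseteq> wreath_map ` carrier (wreath_int A)"
  proof (rule generates)
    show "subgroup (wreath_map ` carrier (wreath_int A)) G" by (rule wreath_map.img_is_subgroup)
    fix a assume a: "a \<in> carrier A"
    let ?d = "\<lambda>i::int. if i = 0 then a else \<one>\<^bsub>A\<^esub>"
    have "lamp_product ?d = finprod N_group (\<lambda>i. conj_u i (\<tau> (?d i))) {0}"
      by (rule lamp_product_eq_finprod) (use a in auto)
    also have "\<dots> = \<tau> a"
      using a \<tau>_in_N N_closed by (subst N.finprod_insert) (auto simp: conj_u_def)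
    finally have "\<tau> a \<otimes> u = wreath_map (?d, 1)" using u_closed by (simp add: wreath_map_def)
    then show "\<tau> a \<otimes> u \<in> wreath_map ` carrier (wreath_int A)"
      using single_in_lamps[OF a] by (auto simp: carrier_wreath)
  qed
  then have "bij_betw wreath_map (carrier (wreath_int A)) (carrier G)"
    using inj wreath_map_hom by (auto simp: bij_betw_def hom_def)
  then have "wreath_int A \<cong> G" by (intro is_isoI) (rule isoI[OF wreath_map_hom])
  then show ?thesis by (rule W.iso_sym)
qed

end

section \<open>The automaton of a fixed-point-free endomorphism\<close>

lemma mult_BijGroup:
  "f \<in> carrier (BijGroup S) \<Longrightarrow> g \<in> carrier (BijGroup S) \<Longrightarrow> f \<otimes>\<^bsub>BijGroup S\<^esub> g = compose S f g"
  by (simp add: BijGroup_def)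

locale fixed_point_free_automaton = comm_group A for A :: "('a, 'k) monoid_scheme" (structure) +
  fixes \<beta> :: "'a \<Rightarrow> 'a"
  assumes finite_carrier: "finite (carrier A)" and fpf: "fixed_point_free A \<beta>"
begin

definition M :: "('a, 'a) mealy" where
  "M = \<lparr>state_set = carrier A, alphabet = carrier A,
        next_state = (\<lambda>q x. q \<otimes> \<beta> x), out_letter = (\<lambda>q x. q \<otimes> x)\<rparr>"

lemma M_simps [simp]:
  "state_set M = carrier A" "alphabet M = carrier A"
  "next_state M = (\<lambda>q x. q \<otimes> \<beta> x)" "out_letter M = (\<otimes>)"
  by (simp_all add: M_def)

lemma \<beta>_hom: "\<beta> \<in> hom A A"
  using fpf by (simp add: fixed_point_free_def)

lemma \<beta>_closed [simp]: "x \<in> carrier A \<Longrightarrow> \<beta> x \<in> carrier A"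
  using \<beta>_hom by (auto simp: hom_def)

lemma \<beta>_mult: "x \<in> carrier A \<Longrightarrow> y \<in> carrier A \<Longrightarrow> \<beta> (x \<otimes> y) = \<beta> x \<otimes> \<beta> y"
  using \<beta>_hom by (auto simp: hom_def)

lemma \<beta>_one [simp]: "\<beta> \<one> = \<one>"
  using hom_one[OF \<beta>_hom is_group is_group] .

lemma \<beta>_inv: "x \<in> carrier A \<Longrightarrow> \<beta> (inv x) = inv (\<beta> x)"
  using group_hom.hom_inv[of A A \<beta> x] \<beta>_hom is_group
  by (simp add: group_hom_def group_hom_axioms_def)

lemma \<beta>_inj: "inj_on \<beta> (carrier A)"
  using fpf by (simp add: fixed_point_free_def)

lemma \<beta>_fixed: "x \<in> carrier A \<Longrightarrow> \<beta> x = x \<Longrightarrow> x = \<one>"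
  using fpf by (simp add: fixed_point_free_def)

lemma bij_if_inj: "f ` carrier A \<subseteq> carrier A \<Longrightarrow> inj_on f (carrier A) \<Longrightarrow> bij_betw f (carrier A) (carrier A)"
  using finite_carrier by (simp add: bij_betw_def endo_inj_surj)

lemma finite_state_automaton_M: "finite_state_automaton M"
  using finite_carrier by (simp add: finite_state_automaton_def mealy_automaton_def)

lemma invertible_M: "invertible_automaton M"
  unfolding invertible_automaton_def
  by (auto intro!: bij_if_inj inj_onI)

text \<open>The absence of nontrivial fixed points makes the inverse automaton reversible: if \<open>q\<close> and \<open>r\<close> have the same successor under some letter, then \<open>inv r \<otimes> q\<close> is fixed
  by \<open>\<beta>\<close>.\<close>
lemma bireversible_M: "bireversible_automaton M"
proof -
  have inv_out: "inv_into (carrier A) (\<lambda>x. q \<otimes> x) y = inv q \<otimes> y"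
    if "q \<in> carrier A" "y \<in> carrier A" for q y
    using that by (intro inv_into_f_eq inj_onI) (auto simp flip: m_assoc)
  have dual: "invertible_automaton (dual_automaton M)"
    unfolding invertible_automaton_def dual_automaton_def
    by (auto intro!: bij_if_inj inj_onI)
  have inverse: "invertible_automaton (inverse_automaton M)"
    using invertible_M unfolding invertible_automaton_def inverse_automaton_def
    by (auto intro: bij_betw_inv_into)
  have "bij_betw (\<lambda>q. q \<otimes> \<beta> (inv_into (carrier A) (\<lambda>x. q \<otimes> x) y)) (carrier A) (carrier A)"
    if y: "y \<in> carrier A" for y
  proof (rule bij_if_inj)
    show "(\<lambda>q. q \<otimes> \<beta> (inv_into (carrier A) (\<lambda>x. q \<otimes> x) y)) ` carrier A \<subseteq> carrier A"
      using y by (auto simp: inv_out)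
    show "inj_on (\<lambda>q. q \<otimes> \<beta> (inv_into (carrier A) (\<lambda>x. q \<otimes> x) y)) (carrier A)"
    proof (rule inj_onI)
      fix q r assume qr: "q \<in> carrier A" "r \<in> carrier A"
        and "q \<otimes> \<beta> (inv_into (carrier A) (\<lambda>x. q \<otimes> x) y) = r \<otimes> \<beta> (inv_into (carrier A) (\<lambda>x. r \<otimes> x) y)"
      then have "(q \<otimes> inv (\<beta> q)) \<otimes> \<beta> y = (r \<otimes> inv (\<beta> r)) \<otimes> \<beta> y"
        using y by (simp add: inv_out \<beta>_mult \<beta>_inv m_assoc)
      then have "q \<otimes> inv (\<beta> q) = r \<otimes> inv (\<beta> r)" using qr y by simp
      then have "q = r \<otimes> inv (\<beta> r) \<otimes> \<beta> q" using qr by (metis \<beta>_closed inv_closed inv_solve_right' m_closed)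
      then have "inv r \<otimes> q = inv (\<beta> r) \<otimes> \<beta> q" using qr by (metis \<beta>_closed inv_closed inv_solve_left' m_assoc m_closed)
      moreover have "\<beta> (inv r \<otimes> q) = inv (\<beta> r) \<otimes> \<beta> q" using qr by (simp add: \<beta>_mult \<beta>_inv)
      ultimately have "\<beta> (inv r \<otimes> q) = inv r \<otimes> q" by simp
      then have "inv r \<otimes> q = \<one>" using qr by (intro \<beta>_fixed) auto
      then show "q = r" using qr by (metis inv_closed inv_equality inv_inv)
    qed
  qed
  then have "invertible_automaton (dual_automaton (inverse_automaton M))"
    unfolding invertible_automaton_def dual_automaton_def inverse_automaton_def
    by simp
  with dual inverse invertible_M show ?thesis
    by (simp add: bireversible_automaton_def reversible_automaton_def)
qed

text \<open>Infinite sequences parametrise the translations of finite words uniformly in the word length: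
  a word of length \<open>n\<close> is translated by the first \<open>n\<close> entries.\<close>
abbreviation "seqs \<equiv> (UNIV :: nat set) \<rightarrow> carrier A"

primrec translate :: "(nat \<Rightarrow> 'a) \<Rightarrow> 'a list \<Rightarrow> 'a list" where
  "translate s [] = []"
| "translate s (x # xs) = (s 0 \<otimes> x) # translate (s \<circ> Suc) xs"

primrec state_after :: "'a \<Rightarrow> (nat \<Rightarrow> 'a) \<Rightarrow> nat \<Rightarrow> 'a" where
  "state_after q s 0 = q"
| "state_after q s (Suc n) = state_after q s n \<otimes> \<beta> (s n)"

text \<open>The action of state \<open>q\<close> on infinite words. For \<open>q = \<one>\<close> it is multiplication by the power
  series \<open>1 + \<beta> t / (1 - t)\<close>.\<close>
definition outputs :: "'a \<Rightarrow> (nat \<Rightarrow> 'a) \<Rightarrow> nat \<Rightarrow> 'a" where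
  "outputs q s n = state_after q s n \<otimes> s n"

lemma seqs_comp_Suc [simp]: "s \<in> seqs \<Longrightarrow> s \<circ> Suc \<in> seqs" by auto

lemma seqsD [simp]: "s \<in> seqs \<Longrightarrow> s n \<in> carrier A" by auto

lemma state_after_closed [simp]: "q \<in> carrier A \<Longrightarrow> s \<in> seqs \<Longrightarrow> state_after q s n \<in> carrier A"
  by (induction n) auto

lemma outputs_in_seqs [simp]: "q \<in> carrier A \<Longrightarrow> s \<in> seqs \<Longrightarrow> outputs q s \<in> seqs"
  by (auto simp: outputs_def)

lemma state_after_comp_Suc: "state_after (q \<otimes> \<beta> (s 0)) (s \<circ> Suc) n = state_after q s (Suc n)"
  by (induction n) auto

lemma outputs_comp_Suc: "outputs q s \<circ> Suc = outputs (q \<otimes> \<beta> (s 0)) (s \<circ> Suc)"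
  by (simp add: outputs_def fun_eq_iff state_after_comp_Suc del: state_after.simps)

lemma translate_in_lists [simp]: "s \<in> seqs \<Longrightarrow> w \<in> lists (carrier A) \<Longrightarrow> translate s w \<in> lists (carrier A)"
  by (induction w arbitrary: s) auto

lemma translate_mult:
  "s \<in> seqs \<Longrightarrow> r \<in> seqs \<Longrightarrow> w \<in> lists (carrier A) \<Longrightarrow>
    translate s (translate r w) = translate (\<lambda>n. s n \<otimes> r n) w"
  by (induction w arbitrary: s r) (auto simp: m_assoc comp_def)

lemma translate_one: "w \<in> lists (carrier A) \<Longrightarrow> translate (\<lambda>_. \<one>) w = w"
  by (induction w) (auto simp: comp_def)

lemma translate_nth: "s \<in> seqs \<Longrightarrow> translate s (replicate (Suc n) \<one>) ! n = s n"
proof (induction n arbitrary: s)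
  case (Suc n)
  from Suc.IH[of "s \<circ> Suc"] Suc.prems show ?case by (auto simp: comp_def)
qed auto

text \<open>The transition and output functions are homomorphisms in state and letter jointly, so the
  automaton acts on a product of inputs as the product of the actions. One of the two inputs is an
  infinite sequence here, which shows how the automaton moves translations past its maps.\<close>
lemma word_map_translate:
  assumes "q \<in> carrier A" "r \<in> carrier A" "s \<in> seqs" "w \<in> lists (carrier A)"
  shows "word_map M (q \<otimes> r) (translate s w) = translate (outputs q s) (word_map M r w)"
  using assms
proof (induction w arbitrary: q r s)
  case (Cons x w)
  then have x: "x \<in> carrier A" "w \<in> lists (carrier A)" by auto
  have "q \<otimes> r \<otimes> \<beta> (s 0 \<otimes> x) = (q \<otimes> \<beta> (s 0)) \<otimes> (r \<otimes> \<beta> x)"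
    using Cons.prems x by (simp add: \<beta>_mult m_ac)
  moreover have "q \<otimes> r \<otimes> (s 0 \<otimes> x) = outputs q s 0 \<otimes> (r \<otimes> x)"
    using Cons.prems x by (simp add: outputs_def m_ac)
  ultimately show ?case
    using Cons.IH[of "q \<otimes> \<beta> (s 0)" "r \<otimes> \<beta> x" "s \<circ> Suc"] Cons.prems x
      outputs_comp_Suc[of q s]
    by (simp add: comp_def)
qed simp

lemma outputs_one: "q \<in> carrier A \<Longrightarrow> outputs q (\<lambda>_. \<one>) = (\<lambda>_. q)"
proof -
  assume q: "q \<in> carrier A"
  have "state_after q (\<lambda>_. \<one>) n = q" for n by (induction n) (use q in auto)
  with q show ?thesis by (simp add: outputs_def fun_eq_iff)
qed

text \<open>Surjectivity is what makes the translations stable also under conjugation by the inverse of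
  a generator. For the preimage, run the inverse automaton: \<open>p n\<close> is the state reached after \<open>n\<close> letters of the wanted
  preimage, and the next letter of the preimage is \<open>inv (p n) \<otimes> s n\<close>.\<close>
lemma outputs_surj:
  assumes s: "s \<in> seqs"
  obtains r where "r \<in> seqs" "outputs \<one> r = s"
proof -
  define p where "p = rec_nat \<one> (\<lambda>n x. x \<otimes> \<beta> (inv x \<otimes> s n))"
  have p: "p 0 = \<one>" "p (Suc n) = p n \<otimes> \<beta> (inv (p n) \<otimes> s n)" for n
    by (simp_all add: p_def)
  have pc: "p n \<in> carrier A" for n by (induction n) (use s p in auto)
  define r where "r n = inv (p n) \<otimes> s n" for n
  have r: "r \<in> seqs" using s pc by (auto simp: r_def)
  have "state_after \<one> r n = p n" for n
    by (induction n) (simp_all add: p r_def)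
  then have "outputs \<one> r n = s n" for n
    using s pc by (simp add: outputs_def r_def flip: m_assoc)
  with r that show ?thesis by blast
qed

definition difference :: "(nat \<Rightarrow> 'a) \<Rightarrow> nat \<Rightarrow> 'a" where
  "difference s n = s (Suc n) \<otimes> inv (s n)"

lemma difference_in_seqs: "s \<in> seqs \<Longrightarrow> difference s \<in> seqs"
  by (auto simp: difference_def)

lemma difference_funpow_in_seqs: "s \<in> seqs \<Longrightarrow> (difference ^^ n) s \<in> seqs"
  by (induction n) (auto simp: difference_in_seqs)

lemma difference_funpow_mult:
  assumes "s \<in> seqs" "r \<in> seqs"
  shows "(difference ^^ n) (\<lambda>i. s i \<otimes> r i) = (\<lambda>i. (difference ^^ n) s i \<otimes> (difference ^^ n) r i)"
proof (induction n)
  case (Suc n)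
  have "(difference ^^ n) s i \<in> carrier A" "(difference ^^ n) r i \<in> carrier A" for i
    using difference_funpow_in_seqs assms by auto
  moreover have "difference (\<lambda>i. x i \<otimes> y i) = (\<lambda>i. difference x i \<otimes> difference y i)"
    if "\<And>i. x i \<in> carrier A" "\<And>i. y i \<in> carrier A" for x y
    using that by (intro ext) (simp add: difference_def inv_mult m_ac)
  ultimately show ?case by (simp add: Suc)
qed simp

lemma difference_funpow_\<beta>: "s \<in> seqs \<Longrightarrow> (difference ^^ n) (\<beta> \<circ> s) = \<beta> \<circ> (difference ^^ n) s"
proof (induction n)
  case (Suc n)
  have "(difference ^^ n) s i \<in> carrier A" for i using difference_funpow_in_seqs[OF Suc.prems] by auto
  moreover have "difference (\<beta> \<circ> x) = \<beta> \<circ> difference x" if "\<And>i. x i \<in> carrier A" for x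
    using that by (intro ext) (simp add: difference_def \<beta>_mult \<beta>_inv)
  ultimately show ?case using Suc by (simp add: comp_def)
qed simp

lemma difference_funpow_one: "(difference ^^ n) (\<lambda>_. \<one>) = (\<lambda>_. \<one>)"
  by (induction n) (auto simp: difference_def)

lemma difference_const: "a \<in> carrier A \<Longrightarrow> difference (\<lambda>_. a) = (\<lambda>_. \<one>)"
  by (auto simp: difference_def)

text \<open>Consecutive outputs involve consecutive states, and these differ by the image under \<open>\<beta>\<close> of the
  letter read in between.\<close>
lemma difference_outputs: "s \<in> seqs \<Longrightarrow> difference (outputs \<one> s) = (\<lambda>n. difference s n \<otimes> (\<beta> \<circ> s) n)"
proof
  fix n assume s: "s \<in> seqs"
  define p where "p = state_after \<one> s n"
  have p: "p \<in> carrier A" using s by (simp add: p_def)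
  have c: "s n \<in> carrier A" "s (Suc n) \<in> carrier A" using s by auto
  have "difference (outputs \<one> s) n = (p \<otimes> \<beta> (s n) \<otimes> s (Suc n)) \<otimes> inv (p \<otimes> s n)"
    by (simp add: difference_def outputs_def p_def)
  also have "\<dots> = (p \<otimes> inv p) \<otimes> (s (Suc n) \<otimes> inv (s n) \<otimes> \<beta> (s n))"
    using p c by (simp only: inv_mult m_ac m_closed inv_closed \<beta>_closed)
  finally show "difference (outputs \<one> s) n = difference s n \<otimes> (\<beta> \<circ> s) n"
    using p c by (simp add: difference_def)
qed

lemma outputs_funpow_in_seqs: "s \<in> seqs \<Longrightarrow> (outputs \<one> ^^ k) s \<in> seqs"
  by (induction k) auto

lemma \<beta>_funpow_closed: "a \<in> carrier A \<Longrightarrow> (\<beta> ^^ k) a \<in> carrier A"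
  by (induction k) auto

lemma \<beta>_funpow_eq_one: "a \<in> carrier A \<Longrightarrow> (\<beta> ^^ k) a = \<one> \<Longrightarrow> a = \<one>"
proof (induction k)
  case (Suc k)
  then have "\<beta> ((\<beta> ^^ k) a) = \<beta> \<one>" by simp
  then have "(\<beta> ^^ k) a = \<one>"
    by (rule inj_onD[OF \<beta>_inj]) (use \<beta>_funpow_closed Suc.prems in auto)
  with Suc show ?case by simp
qed simp

text \<open>Constant sequences correspond to \<open>a / (1 - t)\<close>, so this says that the series
  \<open>u\<^sup>k a / (1 - t)\<close> are in echelon form with respect to iterated differences, with the injective
  maps \<open>\<beta>\<^sup>k\<close> as pivots. The induction trades one factor \<open>u\<close> for one difference by
  \<open>difference_outputs\<close>.\<close>
lemma difference_outputs_triangular: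
  assumes a: "a \<in> carrier A"
  shows "(k < n \<longrightarrow> (difference ^^ n) ((outputs \<one> ^^ k) (\<lambda>_. a)) = (\<lambda>_. \<one>)) \<and>
    (difference ^^ k) ((outputs \<one> ^^ k) (\<lambda>_. a)) = (\<lambda>_. (\<beta> ^^ k) a)"
proof (induction k arbitrary: n)
  case 0
  have "(difference ^^ n) (\<lambda>_. a) = (\<lambda>_. \<one>)" if "n > 0"
    using that a by (cases n) (auto simp: funpow_Suc_right difference_const difference_funpow_one simp del: funpow.simps)
  then show ?case by simp
next
  case (Suc k)
  let ?s = "(outputs \<one> ^^ k) (\<lambda>_. a)"
  have s: "?s \<in> seqs" using a by (intro outputs_funpow_in_seqs) auto
  then have \<beta>s: "\<beta> \<circ> ?s \<in> seqs" by auto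
  have step: "(difference ^^ Suc m) ((outputs \<one> ^^ Suc k) (\<lambda>_. a)) =
      (\<lambda>i. (difference ^^ Suc m) ?s i \<otimes> \<beta> ((difference ^^ m) ?s i))" for m
  proof -
    have "(difference ^^ Suc m) ((outputs \<one> ^^ Suc k) (\<lambda>_. a)) = (difference ^^ m) (difference (outputs \<one> ?s))"
      by (simp add: funpow_swap1)
    also have "\<dots> = (\<lambda>i. (difference ^^ m) (difference ?s) i \<otimes> (difference ^^ m) (\<beta> \<circ> ?s) i)"
      by (simp only: difference_outputs[OF s] difference_funpow_mult[OF difference_in_seqs[OF s] \<beta>s])
    also have "\<dots> = (\<lambda>i. (difference ^^ Suc m) ?s i \<otimes> \<beta> ((difference ^^ m) ?s i))"
      by (simp add: difference_funpow_\<beta>[OF s] funpow_swap1)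
    finally show ?thesis .
  qed
  have "(difference ^^ n) ((outputs \<one> ^^ Suc k) (\<lambda>_. a)) = (\<lambda>_. \<one>)" if n: "Suc k < n"
  proof -
    obtain m where m: "n = Suc m" "k < m" using n by (cases n) auto
    then show ?thesis unfolding m(1) step
      using Suc.IH[of m] Suc.IH[of "Suc m"] by (simp del: funpow.simps)
  qed
  moreover have "(difference ^^ Suc k) ((outputs \<one> ^^ Suc k) (\<lambda>_. a)) = (\<lambda>_. (\<beta> ^^ Suc k) a)"
    unfolding step using Suc.IH[of "Suc k"] a \<beta>_funpow_closed[OF a, of k]
    by (simp del: funpow.simps) (simp add: \<beta>_funpow_closed)
  ultimately show ?case by blast
qed

abbreviation "words \<equiv> lists (carrier A)"
abbreviation "G \<equiv> automaton_group M"

definition word_translation :: "(nat \<Rightarrow> 'a) \<Rightarrow> 'a list \<Rightarrow> 'a list" where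
  "word_translation s = restrict (translate s) words"

definition action :: "'a \<Rightarrow> 'a list \<Rightarrow> 'a list" where
  "action q = restrict (word_map M q) words"

lemma word_translation_in_BijGroup: "s \<in> seqs \<Longrightarrow> word_translation s \<in> carrier (BijGroup words)"
proof -
  assume s: "s \<in> seqs"
  then have i: "(\<lambda>n. inv (s n)) \<in> seqs" by auto
  have "bij_betw (translate s) words words"
    by (rule bij_betw_byWitness[where f' = "translate (\<lambda>n. inv (s n))"])
      (use s i in \<open>auto simp: translate_mult translate_one image_subset_iff simp del: lists_eq_set in_lists_conv_set\<close>)
  then show ?thesis by (simp add: word_translation_def BijGroup_def Bij_def)
qed

lemma action_in_BijGroup: "q \<in> carrier A \<Longrightarrow> action q \<in> carrier (BijGroup words)"
  using word_map_in_BijGroup[of M q] finite_state_automaton_M invertible_M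
  by (simp add: action_def finite_state_automaton_def)

lemma word_map_in_words: "q \<in> carrier A \<Longrightarrow> w \<in> words \<Longrightarrow> word_map M q w \<in> words"
  using word_map_in_lists[of M q w] finite_state_automaton_M
  by (simp add: finite_state_automaton_def)

lemma word_translation_mult:
  assumes "s \<in> seqs" "r \<in> seqs"
  shows "word_translation s \<otimes>\<^bsub>BijGroup words\<^esub> word_translation r = word_translation (\<lambda>n. s n \<otimes> r n)"
  unfolding mult_BijGroup[OF word_translation_in_BijGroup[OF assms(1)] word_translation_in_BijGroup[OF assms(2)]]
  using assms by (auto simp: word_translation_def compose_def fun_eq_iff translate_mult simp del: lists_eq_set in_lists_conv_set)

lemma action_eq:
  assumes q: "q \<in> carrier A"
  shows "action q = word_translation (\<lambda>_. q) \<otimes>\<^bsub>BijGroup words\<^esub> action \<one>"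
proof -
  have "(\<lambda>_. q) \<in> seqs" using q by auto
  then have "word_translation (\<lambda>_. q) \<otimes>\<^bsub>BijGroup words\<^esub> action \<one> = compose words (word_translation (\<lambda>_. q)) (action \<one>)"
    by (intro mult_BijGroup word_translation_in_BijGroup action_in_BijGroup) auto
  moreover have "word_map M q w = translate (\<lambda>_. q) (word_map M \<one> w)" if "w \<in> words" for w
    using word_map_translate[of q \<one> "\<lambda>_. \<one>" w] that q by (simp add: translate_one outputs_one del: lists_eq_set in_lists_conv_set)
  ultimately show ?thesis
    using word_map_in_words[OF one_closed]
    by (auto simp: word_translation_def action_def compose_def fun_eq_iff simp del: lists_eq_set in_lists_conv_set)
qed

lemma action_word_translation:
  assumes s: "s \<in> seqs"
  shows "action \<one> \<otimes>\<^bsub>BijGroup words\<^esub> word_translation s = word_translation (outputs \<one> s) \<otimes>\<^bsub>BijGroup words\<^esub> action \<one>"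
proof -
  have "action \<one> \<otimes>\<^bsub>BijGroup words\<^esub> word_translation s = compose words (action \<one>) (word_translation s)"
    using s by (intro mult_BijGroup word_translation_in_BijGroup action_in_BijGroup) auto
  moreover have "word_translation (outputs \<one> s) \<otimes>\<^bsub>BijGroup words\<^esub> action \<one> = compose words (word_translation (outputs \<one> s)) (action \<one>)"
    using s by (intro mult_BijGroup word_translation_in_BijGroup action_in_BijGroup) auto
  moreover have "word_map M \<one> (translate s w) = translate (outputs \<one> s) (word_map M \<one> w)" if "w \<in> words" for w
    using word_map_translate[of \<one> \<one> s w] that s by simp
  ultimately show ?thesis
    using s word_map_in_words[OF one_closed]
    by (auto simp: word_translation_def action_def compose_def fun_eq_iff simp del: lists_eq_set in_lists_conv_set)
qed

lemma word_translation_one: "word_translation (\<lambda>_. \<one>) = \<one>\<^bsub>BijGroup words\<^esub>"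
  by (auto simp: word_translation_def BijGroup_def translate_one fun_eq_iff simp del: lists_eq_set in_lists_conv_set)

text \<open>Evaluating a translation at the words that consist of identity letters recovers the
  sequence by which it translates. This gives the operators on sequences a meaning on group
  elements.\<close>
definition letters_of :: "('a list \<Rightarrow> 'a list) \<Rightarrow> nat \<Rightarrow> 'a" where
  "letters_of g n = g (replicate (Suc n) \<one>) ! n"

lemma letters_of_word_translation: "s \<in> seqs \<Longrightarrow> letters_of (word_translation s) = s"
proof
  fix n assume s: "s \<in> seqs"
  have "replicate (Suc n) \<one> \<in> words" by auto
  then show "letters_of (word_translation s) n = s n"
    using translate_nth[OF s] by (simp add: letters_of_def word_translation_def del: replicate_Suc lists_eq_set in_lists_conv_set)
qed

interpretation BG: group "BijGroup words" by (rule group_BijGroup)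

interpretation G: group G
  using BG.group_subgroup_generated unfolding automaton_group_def M_simps .

lemma mult_G: "(\<otimes>\<^bsub>G\<^esub>) = (\<otimes>\<^bsub>BijGroup words\<^esub>)" and one_G: "\<one>\<^bsub>G\<^esub> = \<one>\<^bsub>BijGroup words\<^esub>"
  by (simp_all add: automaton_group_def)

lemma G_subset: "g \<in> carrier G \<Longrightarrow> g \<in> carrier (BijGroup words)"
  using BG.carrier_subgroup_generated_subset unfolding automaton_group_def M_simps by blast

lemma action_in_G: "q \<in> carrier A \<Longrightarrow> action q \<in> carrier G"
  unfolding automaton_group_def M_simps carrier_subgroup_generated
  by (rule generate.incl) (use action_in_BijGroup in \<open>auto simp: action_def\<close>)

lemma G_minimal:
  assumes "subgroup H G" "\<And>q. q \<in> carrier A \<Longrightarrow> action q \<in> H"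
  shows "carrier G \<subseteq> H"
proof -
  have "subgroup H (BijGroup words)"
    using assms(1) unfolding automaton_group_def M_simps by (simp add: BG.subgroup_subgroup_generated_iff)
  then show ?thesis
    unfolding automaton_group_def M_simps
    by (rule BG.subgroup_generated_minimal) (use assms(2) in \<open>auto simp: action_def\<close>)
qed

lemma inv_G: "g \<in> carrier G \<Longrightarrow> inv\<^bsub>G\<^esub> g = inv\<^bsub>BijGroup words\<^esub> g"
  unfolding automaton_group_def M_simps by (rule BG.inv_subgroup_generated)

lemma inv_word_translation:
  assumes "s \<in> seqs" shows "inv\<^bsub>BijGroup words\<^esub> (word_translation s) = word_translation (\<lambda>n. inv (s n))"
proof (rule BG.inv_equality)
  have i: "(\<lambda>n. inv (s n)) \<in> seqs" using assms by auto
  show "word_translation (\<lambda>n. inv (s n)) \<otimes>\<^bsub>BijGroup words\<^esub> word_translation s = \<one>\<^bsub>BijGroup words\<^esub>"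
    using assms by (simp add: word_translation_mult[OF i assms] word_translation_one)
  show "word_translation s \<in> carrier (BijGroup words)" "word_translation (\<lambda>n. inv (s n)) \<in> carrier (BijGroup words)"
    using assms i by (auto intro: word_translation_in_BijGroup)
qed

text \<open>The automaton group is countable and the group of all translations in general is not, so the
  abelian subgroup that contains the lamps has to be cut out inside the automaton group.\<close>
definition translation_group :: "('a list \<Rightarrow> 'a list) set" where
  "translation_group = carrier G \<inter> word_translation ` seqs"

text \<open>The translation by the constant sequence \<open>a\<close> is \<open>action a\<close> followed by undoing
  \<open>action \<one>\<close>, hence lies in the automaton group.\<close>
lemma word_translation_const_in_translation_group: "a \<in> carrier A \<Longrightarrow> word_translation (\<lambda>_. a) \<in> translation_group"
proof -
  assume a: "a \<in> carrier A"
  then have s: "(\<lambda>_. a) \<in> seqs" by auto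
  have "action a \<otimes>\<^bsub>G\<^esub> inv\<^bsub>G\<^esub> (action \<one>) \<in> carrier G" using a action_in_G by simp
  moreover have "action a \<otimes>\<^bsub>G\<^esub> inv\<^bsub>G\<^esub> (action \<one>) = word_translation (\<lambda>_. a)"
    unfolding mult_G inv_G[OF action_in_G[OF one_closed]] action_eq[OF a]
    using word_translation_in_BijGroup[OF s] action_in_BijGroup[OF one_closed] by (simp add: BG.m_assoc)
  ultimately show ?thesis using s by (auto simp: translation_group_def)
qed

lemma subgroup_translation_group: "subgroup translation_group G"
proof
  fix x y assume "x \<in> translation_group" "y \<in> translation_group"
  then obtain s r where "x = word_translation s" "y = word_translation r" "s \<in> seqs" "r \<in> seqs" "x \<in> carrier G" "y \<in> carrier G"
    by (auto simp: translation_group_def)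
  moreover from this have "(\<lambda>n. s n \<otimes> r n) \<in> seqs" by auto
  ultimately show "x \<otimes>\<^bsub>G\<^esub> y \<in> translation_group"
    using G.m_closed[of x y] by (simp add: translation_group_def mult_G word_translation_mult)
next
  have "(\<lambda>_. \<one>) \<in> seqs" by auto
  then show "\<one>\<^bsub>G\<^esub> \<in> translation_group" using G.one_closed unfolding translation_group_def one_G word_translation_one[symmetric] by blast
next
  fix x assume "x \<in> translation_group"
  then obtain s where s: "x = word_translation s" "s \<in> seqs" "x \<in> carrier G"
    by (auto simp: translation_group_def)
  moreover from this have "(\<lambda>n. inv (s n)) \<in> seqs" by auto
  ultimately show "inv\<^bsub>G\<^esub> x \<in> translation_group"
    using G.inv_closed[of x] by (simp add: translation_group_def inv_G inv_word_translation)
qed (auto simp: translation_group_def)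

lemma conj_word_translation:
  assumes s: "s \<in> seqs"
  shows "action \<one> \<otimes>\<^bsub>G\<^esub> word_translation s \<otimes>\<^bsub>G\<^esub> inv\<^bsub>G\<^esub> (action \<one>) = word_translation (outputs \<one> s)"
proof -
  have "word_translation (outputs \<one> s) \<in> carrier (BijGroup words)" using s by (intro word_translation_in_BijGroup) auto
  then show ?thesis
    unfolding mult_G inv_G[OF action_in_G[OF one_closed]] action_word_translation[OF s]
    using action_in_BijGroup[OF one_closed] by (simp add: BG.m_assoc)
qed

lemma conj_pow_word_translation:
  assumes s: "s \<in> seqs" and g: "word_translation s \<in> carrier G"
  shows "action \<one> [^]\<^bsub>G\<^esub> (k::nat) \<otimes>\<^bsub>G\<^esub> word_translation s \<otimes>\<^bsub>G\<^esub> inv\<^bsub>G\<^esub> (action \<one> [^]\<^bsub>G\<^esub> k) = word_translation ((outputs \<one> ^^ k) s)"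
proof (induction k)
  case 0
  show ?case using g by simp
next
  case (Suc k)
  let ?u = "action \<one>"
  have u: "?u \<in> carrier G" by (simp add: action_in_G)
  have "?u [^]\<^bsub>G\<^esub> Suc k \<otimes>\<^bsub>G\<^esub> word_translation s \<otimes>\<^bsub>G\<^esub> inv\<^bsub>G\<^esub> (?u [^]\<^bsub>G\<^esub> Suc k) =
      ?u \<otimes>\<^bsub>G\<^esub> (?u [^]\<^bsub>G\<^esub> k \<otimes>\<^bsub>G\<^esub> word_translation s \<otimes>\<^bsub>G\<^esub> inv\<^bsub>G\<^esub> (?u [^]\<^bsub>G\<^esub> k)) \<otimes>\<^bsub>G\<^esub> inv\<^bsub>G\<^esub> ?u"
    using u g unfolding G.nat_pow_Suc2[OF u] by (simp add: G.inv_mult_group G.m_assoc)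
  also have "\<dots> = word_translation (outputs \<one> ((outputs \<one> ^^ k) s))"
    unfolding Suc by (rule conj_word_translation[OF outputs_funpow_in_seqs[OF s]])
  finally show ?case by simp
qed

text \<open>The lamp \<open>a\<close> at the origin is the translation by the constant sequence \<open>a\<close>, and
  \<open>action \<one>\<close> is the step of the lamplighter. The detecting homomorphism \<open>\<theta> n\<close> takes the \<open>n\<close>-th
  difference of the translating sequence and reads off its entry at 0.\<close>
lemma automaton_group_iso_wreath:
  assumes "\<exists>a\<in>carrier A. a \<noteq> \<one>"
  shows "G \<cong> wreath_int A"
proof -
  let ?\<tau> = "\<lambda>a. word_translation (\<lambda>_. a)" and ?\<theta> = "\<lambda>n g. (difference ^^ n) (letters_of g) 0"
  have const: "(\<lambda>_. a) \<in> seqs" if "a \<in> carrier A" for a using that by auto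
  have action_G: "action q = ?\<tau> q \<otimes>\<^bsub>G\<^esub> action \<one>" if "q \<in> carrier A" for q
    using action_eq[OF that] by (simp add: mult_G)
  have \<theta>: "?\<theta> n (action \<one> [^]\<^bsub>G\<^esub> k \<otimes>\<^bsub>G\<^esub> ?\<tau> a \<otimes>\<^bsub>G\<^esub> inv\<^bsub>G\<^esub> (action \<one> [^]\<^bsub>G\<^esub> k)) =
      (difference ^^ n) ((outputs \<one> ^^ k) (\<lambda>_. a)) 0" if a: "a \<in> carrier A" for n k :: nat and a
    using conj_pow_word_translation[OF const[OF a], of k] word_translation_const_in_translation_group[OF a] letters_of_word_translation[OF outputs_funpow_in_seqs[OF const[OF a]]]
    by (simp add: translation_group_def)
  have "lamplighter_frame G A translation_group (action \<one>) ?\<tau> ?\<theta>"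
  proof (intro lamplighter_frame.intro lamplighter_frame_axioms.intro)
    show "?\<tau> \<in> hom A (G\<lparr>carrier := translation_group\<rparr>)"
      using word_translation_const_in_translation_group const by (auto simp: hom_def mult_G word_translation_mult)
    show "?\<theta> n \<in> hom (G\<lparr>carrier := translation_group\<rparr>) A" for n
    proof (rule homI)
      fix x assume "x \<in> carrier (G\<lparr>carrier := translation_group\<rparr>)"
      then obtain s where s: "x = word_translation s" "s \<in> seqs" by (auto simp: translation_group_def)
      then show "?\<theta> n x \<in> carrier A"
        using difference_funpow_in_seqs[of s n] by (simp add: letters_of_word_translation)
    next
      fix x y assume "x \<in> carrier (G\<lparr>carrier := translation_group\<rparr>)" "y \<in> carrier (G\<lparr>carrier := translation_group\<rparr>)"
      then obtain s r where s: "x = word_translation s" "s \<in> seqs" "y = word_translation r" "r \<in> seqs" by (auto simp: translation_group_def)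
      moreover from this have "(\<lambda>n. s n \<otimes> r n) \<in> seqs" by auto
      ultimately show "?\<theta> n (x \<otimes>\<^bsub>G\<lparr>carrier := translation_group\<rparr>\<^esub> y) = ?\<theta> n x \<otimes> ?\<theta> n y"
        by (simp add: letters_of_word_translation mult_G word_translation_mult difference_funpow_mult)
    qed
    show "x \<otimes>\<^bsub>G\<^esub> y = y \<otimes>\<^bsub>G\<^esub> x" if "x \<in> translation_group" "y \<in> translation_group" for x y
      using that by (auto simp: translation_group_def mult_G word_translation_mult) (simp add: m_comm)
    show "action \<one> \<otimes>\<^bsub>G\<^esub> x \<otimes>\<^bsub>G\<^esub> inv\<^bsub>G\<^esub> (action \<one>) \<in> translation_group" if "x \<in> translation_group" for x
    proof -
      from that obtain s where s: "x = word_translation s" "s \<in> seqs" "x \<in> carrier G" by (auto simp: translation_group_def)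
      then have "action \<one> \<otimes>\<^bsub>G\<^esub> x \<otimes>\<^bsub>G\<^esub> inv\<^bsub>G\<^esub> (action \<one>) \<in> carrier G" using action_in_G by simp
      then show ?thesis using s conj_word_translation by (auto simp: translation_group_def)
    qed
    show "inv\<^bsub>G\<^esub> (action \<one>) \<otimes>\<^bsub>G\<^esub> x \<otimes>\<^bsub>G\<^esub> action \<one> \<in> translation_group" if "x \<in> translation_group" for x
    proof -
      from that obtain s where s: "x = word_translation s" "s \<in> seqs" "x \<in> carrier G" by (auto simp: translation_group_def)
      obtain r where r: "r \<in> seqs" "outputs \<one> r = s" using outputs_surj[OF s(2)] .
      have u: "action \<one> \<in> carrier G" by (simp add: action_in_G)
      have ub: "action \<one> \<in> carrier (BijGroup words)" using G_subset u .
      have "inv\<^bsub>G\<^esub> (action \<one>) \<otimes>\<^bsub>G\<^esub> (x \<otimes>\<^bsub>G\<^esub> action \<one>) = inv\<^bsub>G\<^esub> (action \<one>) \<otimes>\<^bsub>G\<^esub> (action \<one> \<otimes>\<^bsub>G\<^esub> word_translation r)"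
        using action_word_translation[OF r(1)] r(2) s(1) by (simp add: mult_G)
      also have "\<dots> = word_translation r"
        using ub word_translation_in_BijGroup[OF r(1)] by (simp add: mult_G inv_G[OF u] flip: BG.m_assoc)
      finally have "inv\<^bsub>G\<^esub> (action \<one>) \<otimes>\<^bsub>G\<^esub> x \<otimes>\<^bsub>G\<^esub> action \<one> = word_translation r" using s u by (simp add: G.m_assoc)
      moreover have "inv\<^bsub>G\<^esub> (action \<one>) \<otimes>\<^bsub>G\<^esub> x \<otimes>\<^bsub>G\<^esub> action \<one> \<in> carrier G" using s u by simp
      ultimately show ?thesis using r by (auto simp: translation_group_def)
    qed
    show "carrier G \<subseteq> H" if "subgroup H G" "\<And>a. a \<in> carrier A \<Longrightarrow> ?\<tau> a \<otimes>\<^bsub>G\<^esub> action \<one> \<in> H" for H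
    proof (rule G_minimal[OF that(1)])
      show "action q \<in> H" if "q \<in> carrier A" for q
        unfolding action_G[OF that] by (rule \<open>\<And>a. a \<in> carrier A \<Longrightarrow> ?\<tau> a \<otimes>\<^bsub>G\<^esub> action \<one> \<in> H\<close>[OF that])
    qed
    show "?\<theta> n (action \<one> [^]\<^bsub>G\<^esub> k \<otimes>\<^bsub>G\<^esub> ?\<tau> a \<otimes>\<^bsub>G\<^esub> inv\<^bsub>G\<^esub> (action \<one> [^]\<^bsub>G\<^esub> k)) = \<one>"
      if "k < n" "a \<in> carrier A" for k n a
      using that \<theta>[of a n k] difference_outputs_triangular[of a k n] by simp
    show "a = \<one>" if "a \<in> carrier A"
      "?\<theta> n (action \<one> [^]\<^bsub>G\<^esub> n \<otimes>\<^bsub>G\<^esub> ?\<tau> a \<otimes>\<^bsub>G\<^esub> inv\<^bsub>G\<^esub> (action \<one> [^]\<^bsub>G\<^esub> n)) = \<one>" for n a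
      using that \<theta>[of a n n] difference_outputs_triangular[of a n n] \<beta>_funpow_eq_one[of a n] by simp
  qed (use assms subgroup_translation_group action_in_G is_group comm_group_axioms G.is_group in auto)
  then show ?thesis by (rule lamplighter_frame.wreath_int_iso)
qed

end

section \<open>Existence of the bireversible automaton\<close>

theorem corollary4p6:
  fixes A :: "('a, 'k) monoid_scheme"
    and A1 :: "('b, 'l) monoid_scheme"
    and A2 :: "('c, 'm) monoid_scheme"
    and a :: "nat \<Rightarrow> nat"
    and t :: nat
  assumes "comm_group A" and "finite (carrier A)" and "order A \<noteq> 1"
    and "group A1" and "group A2"
    and "A \<cong> A1 \<times>\<times> A2"
    and "odd (order A1)"
    and "A2 \<cong> sum_group {1..t} (\<lambda>i. sum_group {1..a i} (\<lambda>_. integer_mod_group (2 ^ i)))"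
    and "\<forall>i\<in>{1..t}. a i \<noteq> 1"
  shows "\<exists>M :: ('a, 'a) mealy.
           finite_state_automaton M \<and>
           bireversible_automaton M \<and>
           card (alphabet M) = order A \<and>
           card (state_set M) = order A \<and>
           automaton_group M \<cong> wreath_int A"
proof -
  interpret A: comm_group A by fact
  have "comm_group (A1 \<times>\<times> A2)"
    using A.iso_imp_comm_group[OF \<open>A \<cong> A1 \<times>\<times> A2\<close>] DirProd_group[OF \<open>group A1\<close> \<open>group A2\<close>]
    by (simp add: group.is_monoid)
  then interpret A1: comm_group A1
    by (rule DirProd_comm_imp_left_comm[OF \<open>group A1\<close> \<open>group A2\<close>])
  let ?C = "\<lambda>i. integer_mod_group (2 ^ i)"
  let ?P = "\<lambda>i. sum_group {1..a i} (\<lambda>_. ?C i)"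
  have "fixed_point_free (?P i) (twisted_shift (?C i) (a i))" if "i \<in> {1..t}" for i
    using assms(9) that by (intro comm_group.fixed_point_free_power) auto
  then have "fixed_point_free (sum_group {1..t} ?P) (\<lambda>x. \<lambda>i\<in>{1..t}. twisted_shift (?C i) (a i) (x i))"
    by (intro fixed_point_free_sum_group) auto
  then obtain \<gamma> where "fixed_point_free A2 \<gamma>"
    using fixed_point_free_is_iso[OF \<open>group A2\<close> _ assms(8)] by auto
  then have "fixed_point_free (A1 \<times>\<times> A2) (map_prod (\<lambda>x. inv\<^bsub>A1\<^esub> x) \<gamma>)"
    using A1.fixed_point_free_inv_odd_order[OF \<open>odd (order A1)\<close>] by (intro fixed_point_free_DirProd)
  then obtain \<beta> where \<beta>: "fixed_point_free A \<beta>"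
    using fixed_point_free_is_iso[OF A.is_group DirProd_group[OF \<open>group A1\<close> \<open>group A2\<close>] \<open>A \<cong> A1 \<times>\<times> A2\<close>]
    by blast
  interpret fixed_point_free_automaton A \<beta> by unfold_locales fact+
  \<comment> \<open>For trivial \<open>A\<close> the wreath product is \<open>\<int>\<close>, while a one-letter alphabet only allows the
    trivial automaton group.\<close>
  have "\<exists>x\<in>carrier A. x \<noteq> \<one>\<^bsub>A\<^esub>"
  proof (rule ccontr)
    assume "\<not> ?thesis"
    then have "carrier A = {\<one>\<^bsub>A\<^esub>}" by auto
    then show False using \<open>order A \<noteq> 1\<close> by (simp add: order_def)
  qed
  then have "automaton_group M \<cong> wreath_int A" by (rule automaton_group_iso_wreath)
  then show ?thesis
    using finite_state_automaton_M bireversible_M by (intro exI[of _ M]) (simp add: order_def)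
qed

end
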